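(* Let $L>0$ and $\omega>\frac{\pi^2}{2L^2}$ be fixed. Let $Z_0>0$ and let $\Pi:(-Z_0,Z_0)\to\mathbb R$ be an analytic function with $\Pi(0)=0$ such that, for all $Z\in(-Z_0,Z_0)$, $\Pi(Z)$ is the simple isolated second eigenvalue of $\mathcal L_{1,Z}$, and the spectrum of $\mathcal L_{1,Z}$ is positive except for its first two eigenvalues. Then there exists $0<Z_1<Z_0$ such that $\Pi(Z)<0$ for any $Z\in(-Z_1,0)$ and $\Pi(Z)>0$ for any $Z\in(0,Z_1)$. Therefore, for $Z$ negative and small $\mathcal L_{1,Z}$ has exactly two negative eigenvalues, and for $Z$ positive and small $\mathcal L_{1,Z}$ has exactly one negative eigenvalue.
   Context: $\mathcal L_{1,Z}\zeta=-\zeta''+\omega\zeta-3\varphi_{\omega,Z}^2\zeta$ is self-adjoint on $L^2_{per}([-L,L])$ ($2L$-periodic functions) with domain $\{\zeta\in H^1_{per}([-L,L])\cap H^2((-L,L)\setminus\{0\})\cap H^2((0,2L)):\zeta'(0+)-\zeta'(0-)=-Z\zeta(0)\}$ (derivatives taken away from $2L\mathbb Z$). Eigenvalues are ordered increasingly. (The existence of such $Z_0$ and $\Pi$, with an analytic family of eigenvectors $\Omega(Z)$, $\Omega(0)=\phi_{\omega,0}'$, is established in the paper.) Profiles: $\mathrm{dn}(\cdot;k)$ is the Jacobi elliptic function of modulus $k\in(0,1)$, $K(k)$ the complete elliptic integral of the first kind, and for $y\in[\sqrt{1-k^2},1]$, $\mathrm{dn}^{-1}(y;k)$ is the unique $u\in[0,K(k)]$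 with $\mathrm{dn}(u;k)=y$. Put $k^2(\eta,\omega)=\frac{2\omega-2\eta^2}{2\omega-\eta^2}$. For $Z=0$: let $\eta_2(0)\in(0,\sqrt\omega)$ be the unique value with $\frac{2\sqrt2}{\sqrt{2\omega-\eta^2}}K(k(\eta,\omega))=2L$ at $\eta=\eta_2(0)$, $\eta_1=\sqrt{2\omega-\eta_2(0)^2}$ and $\varphi_{\omega,0}=\phi_{\omega,0}$, $\phi_{\omega,0}(\xi)=\eta_1\mathrm{dn}(\frac{\eta_1}{\sqrt2}\xi;k(\eta_2(0),\omega))$. For $Z\ne0$ small, put $$\Phi^2(\eta)=\tfrac12\Big[(2\omega-\tfrac{Z^2}{2})+\sqrt{(2\omega-\tfrac{Z^2}{2})^2-4\eta^2(2\omega-\eta^2)}\Big]\ (\Phi>0),\qquad a(\eta)=\mathrm{dn}^{-1}\Big(\frac{\Phi(\eta)}{\sqrt{2\omega-\eta^2}};k(\eta,\omega)\Big)$$ for $0<\eta<-\frac{\sqrt2}{4}|Z|+\sqrt{\omega-\frac{Z^2}{8}}$, and let $\eta_2(Z)$ be the solution of $\frac{2\sqrt2}{\sqrt{2\omega-\eta^2}}[K(k(\eta,\omega))-\mathrm{sgn}(Z)\,a(\eta)]=2L$ on the smooth branch with $\eta_2(Z)\to\eta_2(0)$ as $Z\to0$. With $\eta_1=\sqrt{2\omega-\eta_2(Z)^2}$, $k=k(\eta_2(Z),\omega)$, $a=a(\eta_2(Z))$, set $\varphi_{\omega,Z}(\xi)=\eta_1\mathrm{dn}\big(\frac{\eta_1}{\sqrt2}|\xi|+\mathrm{sgn}(Z)a;k\big)$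 for $\xi\in[-L,L]$, extended $2L$-periodically. Then $\varphi_{\omega,Z}$ is positive, even, solves $-\varphi''+\omega\varphi-Z\delta(x)\varphi=\varphi^3$, depends real-analytically on $Z$ in $H^1_{per}([-L,L])$, and $\varphi_{\omega,Z}\to\phi_{\omega,0}$ in $H^1_{per}([-L,L])$ as $Z\to0$. *)

theory Defs
  imports "HOL-Analysis.Analysis" "HOL-Library.Function_Algebras"
begin

section \<open>Elliptic functions\<close>

definition ellF :: "real \<Rightarrow> real \<Rightarrow> real" where
  "ellF \<theta> k = (LBINT t=0..ereal \<theta>. 1 / sqrt (1 - k\<^sup>2 * (sin t)\<^sup>2))"

definition ellK :: "real \<Rightarrow> real" where
  "ellK k = ellF (pi / 2) k"

text \<open>For \<open>0 < k < 1\<close> the map \<open>\<theta> \<mapsto> ellF \<theta> k\<close> is a bijection of the real line; its inverse is the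
  Jacobi amplitude.\<close>

definition jacobi_am :: "real \<Rightarrow> real \<Rightarrow> real" where
  "jacobi_am u k = (THE \<theta>. ellF \<theta> k = u)"

definition jacobi_dn :: "real \<Rightarrow> real \<Rightarrow> real" where
  "jacobi_dn u k = sqrt (1 - k\<^sup>2 * (sin (jacobi_am u k))\<^sup>2)"

definition jacobi_dn_inv :: "real \<Rightarrow> real \<Rightarrow> real" where
  "jacobi_dn_inv y k = (THE u. u \<in> {0..ellK k} \<and> jacobi_dn u k = y)"


section \<open>The profiles\<close>

definition modulus :: "real \<Rightarrow> real \<Rightarrow> real" where
  "modulus \<omega> \<eta> = sqrt ((2 * \<omega> - 2 * \<eta>\<^sup>2) / (2 * \<omega> - \<eta>\<^sup>2))"

definition Phi :: "real \<Rightarrow> real \<Rightarrow> real \<Rightarrow> real" where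
  "Phi \<omega> Z \<eta> = sqrt (1 / 2 * ((2 * \<omega> - Z\<^sup>2 / 2)
     + sqrt ((2 * \<omega> - Z\<^sup>2 / 2)\<^sup>2 - 4 * \<eta>\<^sup>2 * (2 * \<omega> - \<eta>\<^sup>2))))"

definition shift :: "real \<Rightarrow> real \<Rightarrow> real \<Rightarrow> real" where
  "shift \<omega> Z \<eta> = jacobi_dn_inv (Phi \<omega> Z \<eta> / sqrt (2 * \<omega> - \<eta>\<^sup>2)) (modulus \<omega> \<eta>)"

text \<open>The branch \<open>Z \<mapsto> \<eta>\<^sub>2 Z\<close> of solutions of the period equation, smooth across \<open>Z = 0\<close>.\<close>

definition eta2_branch :: "real \<Rightarrow> real \<Rightarrow> real \<Rightarrow> (real \<Rightarrow> real) \<Rightarrow> bool" where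
  "eta2_branch L \<omega> Z0 \<eta>\<^sub>2 \<longleftrightarrow>
     \<eta>\<^sub>2 0 \<in> {0<..<sqrt \<omega>} \<and>
     2 * sqrt 2 / sqrt (2 * \<omega> - (\<eta>\<^sub>2 0)\<^sup>2) * ellK (modulus \<omega> (\<eta>\<^sub>2 0)) = 2 * L \<and>
     (\<forall>Z \<in> {-Z0<..<Z0} - {0}.
        0 < \<eta>\<^sub>2 Z \<and> \<eta>\<^sub>2 Z < - (sqrt 2 / 4) * \<bar>Z\<bar> + sqrt (\<omega> - Z\<^sup>2 / 8) \<and>
        2 * sqrt 2 / sqrt (2 * \<omega> - (\<eta>\<^sub>2 Z)\<^sup>2)
          * (ellK (modulus \<omega> (\<eta>\<^sub>2 Z)) - sgn Z * shift \<omega> Z (\<eta>\<^sub>2 Z)) = 2 * L) \<and>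
     (\<forall>n. (deriv ^^ n) \<eta>\<^sub>2 differentiable_on {-Z0<..<Z0}) \<and>
     (\<eta>\<^sub>2 \<longlongrightarrow> \<eta>\<^sub>2 0) (at 0)"

definition periodic_extension :: "real \<Rightarrow> (real \<Rightarrow> real) \<Rightarrow> real \<Rightarrow> real" where
  "periodic_extension L f x = f (x - 2 * L * of_int \<lfloor>(x + L) / (2 * L)\<rfloor>)"

definition profile :: "real \<Rightarrow> real \<Rightarrow> (real \<Rightarrow> real) \<Rightarrow> real \<Rightarrow> real \<Rightarrow> real" where
  "profile L \<omega> \<eta>\<^sub>2 Z =
     (let \<eta>\<^sub>1 = sqrt (2 * \<omega> - (\<eta>\<^sub>2 Z)\<^sup>2); k = modulus \<omega> (\<eta>\<^sub>2 Z); a = shift \<omega> Z (\<eta>\<^sub>2 Z)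
      in if Z = 0 then (\<lambda>\<xi>. \<eta>\<^sub>1 * jacobi_dn (\<eta>\<^sub>1 / sqrt 2 * \<xi>) k)
         else periodic_extension L (\<lambda>\<xi>. \<eta>\<^sub>1 * jacobi_dn (\<eta>\<^sub>1 / sqrt 2 * \<bar>\<xi>\<bar> + sgn Z * a) k))"


section \<open>Function spaces\<close>

definition L2_on :: "real set \<Rightarrow> (real \<Rightarrow> complex) \<Rightarrow> bool" where
  "L2_on S f \<longleftrightarrow> set_borel_measurable lebesgue S f \<and> set_integrable lebesgue S (\<lambda>x. (norm (f x))\<^sup>2)"

definition periodic :: "real \<Rightarrow> (real \<Rightarrow> complex) \<Rightarrow> bool" where
  "periodic L f \<longleftrightarrow> (\<forall>x. f (x + 2 * L) = f x)"

text \<open>\<open>L2_per\<close> consists of functions, not of classes modulo null sets; the quotient is accounted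
  for by almost-everywhere equality in the definition of the operator.\<close>

definition L2_per :: "real \<Rightarrow> (real \<Rightarrow> complex) set" where
  "L2_per L = {f. periodic L f \<and> L2_on {-L..L} f}"

definition L2_norm :: "real \<Rightarrow> (real \<Rightarrow> complex) \<Rightarrow> real" where
  "L2_norm L f = sqrt (LINT x:{-L..L}|lebesgue. (norm (f x))\<^sup>2)"

text \<open>\<open>f\<close> is locally absolutely continuous on the open set \<open>I\<close> with derivative \<open>g\<close>. In dimension one
  the Sobolev spaces are the spaces of (locally) absolutely continuous functions with square
  integrable derivatives; a Sobolev function is always represented by its continuous version.\<close>

definition ac_deriv :: "real set \<Rightarrow> (real \<Rightarrow> complex) \<Rightarrow> (real \<Rightarrow> complex) \<Rightarrow> bool" where
  "ac_deriv I f g \<longleftrightarrow> (\<forall>a b. a \<le> b \<and> {a..b} \<subseteq> I \<longrightarrow>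
     set_integrable lebesgue {a..b} g \<and> f b - f a = (LINT x:{a..b}|lebesgue. g x))"

definition H1_per :: "real \<Rightarrow> (real \<Rightarrow> complex) set" where
  "H1_per L = {f \<in> L2_per L. \<exists>g. ac_deriv UNIV f g \<and> L2_on {-L..L} g}"

definition H2_on :: "real set \<Rightarrow> (real \<Rightarrow> complex) set" where
  "H2_on I = {f. L2_on I f \<and>
     (\<exists>g h. ac_deriv I f g \<and> L2_on I g \<and> ac_deriv I g h \<and> L2_on I h)}"


section \<open>The operator\<close>

text \<open>Away from \<open>2L\<int>\<close> the functions in the domain are continuously differentiable, so that their
  first derivative is the classical one.\<close>

definition D1 :: "(real \<Rightarrow> complex) \<Rightarrow> real \<Rightarrow> complex" where
  "D1 f = (\<lambda>x. vector_derivative f (at x))"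

definition L1_domain :: "real \<Rightarrow> real \<Rightarrow> (real \<Rightarrow> complex) set" where
  "L1_domain L Z = {\<zeta> \<in> H1_per L \<inter> H2_on ({-L<..<L} - {0}) \<inter> H2_on {0<..<2 * L}.
     \<exists>p m. (D1 \<zeta> \<longlongrightarrow> p) (at_right 0) \<and> (D1 \<zeta> \<longlongrightarrow> m) (at_left 0) \<and>
           p - m = - of_real Z * \<zeta> 0}"

text \<open>The graph of \<open>-\<zeta>'' + \<omega> \<zeta> - 3 \<phi>\<^sup>2 \<zeta>\<close>. The second component ranges over all representatives of
  the image, the first one only over the continuous representative.\<close>

definition L1_graph ::
    "real \<Rightarrow> real \<Rightarrow> real \<Rightarrow> (real \<Rightarrow> real) \<Rightarrow> ((real \<Rightarrow> complex) \<times> (real \<Rightarrow> complex)) set" where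
  "L1_graph L \<omega> Z \<phi> = {(\<zeta>, \<eta>). \<zeta> \<in> L1_domain L Z \<and> \<eta> \<in> L2_per L \<and>
     (\<exists>h. ac_deriv (- range (\<lambda>n::int. 2 * L * of_int n)) (D1 \<zeta>) h \<and>
        (AE x in lebesgue. \<eta> x = - h x + of_real \<omega> * \<zeta> x - 3 * of_real ((\<phi> x)\<^sup>2) * \<zeta> x))}"

definition L1_op ::
    "real \<Rightarrow> real \<Rightarrow> (real \<Rightarrow> real) \<Rightarrow> real \<Rightarrow> ((real \<Rightarrow> complex) \<times> (real \<Rightarrow> complex)) set" where
  "L1_op L \<omega> \<eta>\<^sub>2 Z = L1_graph L \<omega> Z (profile L \<omega> \<eta>\<^sub>2 Z)"


section \<open>Spectral notions for an operator given by its graph\<close>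

definition resolvent_set :: "real \<Rightarrow> ((real \<Rightarrow> complex) \<times> (real \<Rightarrow> complex)) set \<Rightarrow> complex set" where
  "resolvent_set L A = {z.
     (\<forall>h \<in> L2_per L. \<exists>!\<zeta>. (\<zeta>, \<lambda>x. h x + z * \<zeta> x) \<in> A) \<and>
     (\<exists>C. \<forall>h \<in> L2_per L. \<forall>\<zeta>. (\<zeta>, \<lambda>x. h x + z * \<zeta> x) \<in> A \<longrightarrow> L2_norm L \<zeta> \<le> C * L2_norm L h)}"

definition spectrum :: "real \<Rightarrow> ((real \<Rightarrow> complex) \<times> (real \<Rightarrow> complex)) set \<Rightarrow> complex set" where
  "spectrum L A = - resolvent_set L A"

definition eigenspace ::
    "((real \<Rightarrow> complex) \<times> (real \<Rightarrow> complex)) set \<Rightarrow> real \<Rightarrow> (real \<Rightarrow> complex) set" where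
  "eigenspace A \<mu> = {\<zeta>. (\<zeta>, \<lambda>x. of_real \<mu> * \<zeta> x) \<in> A}"

definition eigenvalue :: "((real \<Rightarrow> complex) \<times> (real \<Rightarrow> complex)) set \<Rightarrow> real \<Rightarrow> bool" where
  "eigenvalue A \<mu> \<longleftrightarrow> (\<exists>\<zeta> \<in> eigenspace A \<mu>. \<zeta> \<noteq> 0)"

text \<open>Eigenfunctions solve a linear second order differential equation on \<open>(0, 2L)\<close>, so eigenspaces
  have dimension at most two and the convention that infinite dimension is \<open>0\<close> plays no role.\<close>

definition eig_multiplicity :: "((real \<Rightarrow> complex) \<times> (real \<Rightarrow> complex)) set \<Rightarrow> real \<Rightarrow> nat" where
  "eig_multiplicity A \<mu> = vector_space.dim (\<lambda>(c::complex) f x. c * f x) (eigenspace A \<mu>)"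

definition eigenvalue_count_below ::
    "((real \<Rightarrow> complex) \<times> (real \<Rightarrow> complex)) set \<Rightarrow> real \<Rightarrow> nat \<Rightarrow> bool" where
  "eigenvalue_count_below A \<mu> n \<longleftrightarrow>
     finite {\<nu>. eigenvalue A \<nu> \<and> \<nu> < \<mu>} \<and> (\<Sum>\<nu> | eigenvalue A \<nu> \<and> \<nu> < \<mu>. eig_multiplicity A \<nu>) = n"

text \<open>\<open>\<mu>\<close> is the \<open>j\<close>-th eigenvalue (\<open>j = 1, 2, \<dots>\<close>) when the eigenvalues are listed in increasing order,
  each one repeated according to its multiplicity.\<close>

definition nth_eigenvalue :: "((real \<Rightarrow> complex) \<times> (real \<Rightarrow> complex)) set \<Rightarrow> nat \<Rightarrow> real \<Rightarrow> bool" where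
  "nth_eigenvalue A j \<mu> \<longleftrightarrow> eigenvalue A \<mu> \<and>
     (\<exists>n. eigenvalue_count_below A \<mu> n \<and> n < j \<and> j \<le> n + eig_multiplicity A \<mu>)"


section \<open>Real analytic functions\<close>

definition real_analytic_on :: "(real \<Rightarrow> real) \<Rightarrow> real set \<Rightarrow> bool" where
  "real_analytic_on f S \<longleftrightarrow> (\<forall>x\<^sub>0 \<in> S. \<exists>r > 0. \<exists>c. \<forall>x. \<bar>x - x\<^sub>0\<bar> < r \<longrightarrow>
     (\<lambda>n. c n * (x - x\<^sub>0) ^ n) sums f x)"

end

theory Submission
  imports Defs
begin

text \<open>On \<open>(0, 2L)\<close> the profile is the restriction of a smooth function \<open>\<Psi>\<close> on the line, symmetric about
  \<open>L\<close>, with \<open>\<Psi>'' = \<omega>\<Psi> - \<Psi>\<^sup>3\<close> and \<open>\<Psi>' 0 = - (Z / 2) \<Psi> 0\<close>. The parts of an eigenfunction that are even and odd about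
  \<open>L\<close> are solutions \<open>v\<close>, \<open>w\<close> on \<open>[0, L]\<close> of \<open>y'' = (\<omega> - 3\<Psi>\<^sup>2 - \<nu>) y\<close> with \<open>v' L = 0\<close>,
  \<open>v' 0 + (Z / 2) v 0 = 0\<close> and \<open>w L = 0\<close>, \<open>w 0 = 0\<close>. Solving from \<open>L\<close> backwards makes everything depend
  continuously on \<open>(Z, \<nu>)\<close> at \<open>(0, 0)\<close> by a Gronwall estimate, since \<open>\<Psi> L = \<eta>\<^sub>2 Z\<close> and \<open>\<Psi>' L = 0\<close>; continuity
  in the elliptic modulus is never needed. As \<open>\<Psi>'\<close> spans the kernel at \<open>Z = 0\<close>, the even boundary
  condition fails at \<open>(0, 0)\<close>, hence near \<open>(0, 0)\<close>. So for small \<open>Z\<close> every small eigenvalue \<open>\<nu>\<close> is odd,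
  and its \<open>w\<close> is close to a multiple of \<open>\<Psi>'\<close>. Comparing Wronskians of two such \<open>w\<close> shows that there is
  at most one such \<open>\<nu>\<close>, and comparing \<open>w\<close> with \<open>\<Psi>'\<close> gives \<open>(Z / 2) \<Psi> 0 w' 0 = - \<nu> \<integral> w \<Psi>'\<close>, so that \<open>\<nu>\<close>
  has the sign of \<open>Z\<close>.\<close>

section \<open>The Jacobi function dn\<close>

lemma elliptic_radicand_pos:
  fixes k t :: real
  assumes "k\<^sup>2 < 1"
  shows "0 < 1 - k\<^sup>2 * (sin t)\<^sup>2"
proof -
  have "k\<^sup>2 * (sin t)\<^sup>2 \<le> k\<^sup>2 * 1"
    by (intro mult_left_mono) (auto simp: abs_square_le_1)
  then show ?thesis using assms by simp
qed

lemma has_real_derivative_ellF: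
  assumes "k\<^sup>2 < 1"
  shows "((\<lambda>\<theta>. ellF \<theta> k) has_real_derivative 1 / sqrt (1 - k\<^sup>2 * (sin \<theta>)\<^sup>2)) (at \<theta>)"
proof -
  let ?f = "\<lambda>t. 1 / sqrt (1 - k\<^sup>2 * (sin t)\<^sup>2)"
  define b where "b = \<bar>\<theta>\<bar> + 1"
  have cont: "continuous_on {-b..b} ?f"
    using elliptic_radicand_pos[OF assms] by (intro continuous_intros) (simp add: less_imp_neq[symmetric])
  have "((\<lambda>u. LBINT t=ereal 0..ereal u. ?f t) has_vector_derivative ?f \<theta>) (at \<theta> within {-b..b})"
    by (rule interval_integral_FTC2[OF _ _ cont]) (auto simp: b_def)
  moreover have "at \<theta> within {-b..b} = at \<theta>"
    by (rule at_within_interior) (auto simp: b_def)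
  ultimately show ?thesis
    by (simp add: ellF_def[abs_def] has_real_derivative_iff_has_vector_derivative zero_ereal_def)
qed

lemma ellF_0 [simp]: "ellF 0 k = 0"
  by (simp add: ellF_def zero_ereal_def interval_integral_endpoints_same)

text \<open>The integrand is at least 1, so \<open>ellF\<close> never shrinks distances. Injectivity
  and surjectivity of \<open>ellF\<close> both come from this bound.\<close>

lemma ellF_diff_ge:
  assumes k: "k\<^sup>2 < 1" and "x \<le> y"
  shows "y - x \<le> ellF y k - ellF x k"
proof -
  have "ellF x k - x \<le> ellF y k - y"
  proof (rule DERIV_nonneg_imp_nondecreasing[OF \<open>x \<le> y\<close>])
    fix t
    have "1 \<le> 1 / sqrt (1 - k\<^sup>2 * (sin t)\<^sup>2)"
      using elliptic_radicand_pos[OF k, of t] by simp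
    then show "\<exists>d. ((\<lambda>x. ellF x k - x) has_real_derivative d) (at t) \<and> 0 \<le> d"
      by (intro exI[of _ "1 / sqrt (1 - k\<^sup>2 * (sin t)\<^sup>2) - 1"] conjI derivative_intros
          has_real_derivative_ellF k) auto
  qed
  then show ?thesis by simp
qed

lemma ellF_eq_iff:
  assumes "k\<^sup>2 < 1" shows "ellF x k = ellF y k \<longleftrightarrow> x = y"
  using ellF_diff_ge[OF assms, of x y] ellF_diff_ge[OF assms, of y x] by fastforce

lemma ellF_surj:
  assumes "k\<^sup>2 < 1" shows "\<exists>\<theta>. ellF \<theta> k = u"
proof -
  have "ellF (-\<bar>u\<bar>) k \<le> u" "u \<le> ellF \<bar>u\<bar> k"
    using ellF_diff_ge[OF assms, of "-\<bar>u\<bar>" 0] ellF_diff_ge[OF assms, of 0 "\<bar>u\<bar>"] by auto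
  then have "\<exists>\<theta>\<ge>-\<bar>u\<bar>. \<theta> \<le> \<bar>u\<bar> \<and> ellF \<theta> k = u"
    by (intro IVT) (auto intro: DERIV_isCont has_real_derivative_ellF[OF assms])
  then show ?thesis by blast
qed

lemma ellF_am [simp]:
  assumes "k\<^sup>2 < 1" shows "ellF (jacobi_am u k) k = u"
proof -
  have "\<exists>!\<theta>. ellF \<theta> k = u"
    using ellF_surj[OF assms] ellF_eq_iff[OF assms] by metis
  then show ?thesis unfolding jacobi_am_def by (rule theI')
qed

lemma am_eqI: "k\<^sup>2 < 1 \<Longrightarrow> ellF \<theta> k = u \<Longrightarrow> jacobi_am u k = \<theta>"
  by (metis ellF_am ellF_eq_iff)

lemma has_real_derivative_am:
  assumes k: "k\<^sup>2 < 1"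
  shows "((\<lambda>u. jacobi_am u k) has_real_derivative jacobi_dn u k) (at u)"
proof -
  let ?\<theta> = "jacobi_am u k"
  have "isCont (\<lambda>u. jacobi_am u k) (ellF ?\<theta> k)"
    by (rule isCont_inverse_function[where d = 1])
      (auto intro!: DERIV_isCont has_real_derivative_ellF am_eqI k)
  then have "isCont (\<lambda>u. jacobi_am u k) u" using k by simp
  moreover have "1 / sqrt (1 - k\<^sup>2 * (sin ?\<theta>)\<^sup>2) \<noteq> 0"
    using elliptic_radicand_pos[OF k, of ?\<theta>] by simp
  ultimately have "((\<lambda>u. jacobi_am u k) has_real_derivative
      inverse (1 / sqrt (1 - k\<^sup>2 * (sin ?\<theta>)\<^sup>2))) (at u)"
    using k by (intro DERIV_inverse_function[where f = "\<lambda>\<theta>. ellF \<theta> k" and a = "u - 1" and b = "u + 1"]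
      has_real_derivative_ellF) auto
  then show ?thesis by (simp add: jacobi_dn_def)
qed

section \<open>dn and its differential equations\<close>

lemma dn_pos: "k\<^sup>2 < 1 \<Longrightarrow> 0 < jacobi_dn u k"
  unfolding jacobi_dn_def using elliptic_radicand_pos[of k "jacobi_am u k"] by simp

lemma dn_sq: "k\<^sup>2 < 1 \<Longrightarrow> (jacobi_dn u k)\<^sup>2 = 1 - k\<^sup>2 * (sin (jacobi_am u k))\<^sup>2"
  using elliptic_radicand_pos[of k "jacobi_am u k"] by (simp add: jacobi_dn_def)

text \<open>In Jacobi's notation this is \<open>- k\<^sup>2 sn cn\<close>, the derivative of dn in
  its argument.\<close>

definition dn_deriv :: "real \<Rightarrow> real \<Rightarrow> real" where
  "dn_deriv u k = - k\<^sup>2 * (sin (jacobi_am u k) * cos (jacobi_am u k))"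

lemma has_real_derivative_dn:
  assumes k: "k\<^sup>2 < 1"
  shows "((\<lambda>u. jacobi_dn u k) has_real_derivative dn_deriv u k) (at u)"
proof -
  let ?r = "\<lambda>u. 1 - k\<^sup>2 * (sin (jacobi_am u k))\<^sup>2"
  have "(?r has_real_derivative 2 * dn_deriv u k * jacobi_dn u k) (at u)"
    by (rule derivative_eq_intros has_real_derivative_am[OF k] refl)+ (simp add: dn_deriv_def)
  then have "((\<lambda>u. sqrt (?r u)) has_real_derivative
      inverse (sqrt (?r u)) / 2 * (2 * dn_deriv u k * jacobi_dn u k)) (at u)"
    by (rule DERIV_chain2[where g = ?r, OF DERIV_real_sqrt[OF elliptic_radicand_pos[OF k]]])
  then show ?thesis
    using dn_pos[OF k, of u] by (simp add: jacobi_dn_def[abs_def] field_simps)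
qed

text \<open>Differentiating \<open>- k\<^sup>2 sn cn\<close> leaves squares of sine and cosine,
  which are eliminated in favour of dn. Scaling turns the result into the profile equation.\<close>

lemma has_real_derivative_dn_deriv:
  assumes k: "k\<^sup>2 < 1"
  shows "((\<lambda>u. dn_deriv u k) has_real_derivative
    (2 - k\<^sup>2) * jacobi_dn u k - 2 * (jacobi_dn u k)^3) (at u)"
proof -
  let ?s = "sin (jacobi_am u k)" and ?c = "cos (jacobi_am u k)" and ?d = "jacobi_dn u k"
  have "((\<lambda>u. dn_deriv u k) has_real_derivative - k\<^sup>2 * (?c * ?d * ?c + - ?s * ?d * ?s)) (at u)"
    unfolding dn_deriv_def
    by (rule derivative_eq_intros has_real_derivative_am[OF k] refl)+ (simp add: algebra_simps power2_eq_square)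
  also have "- k\<^sup>2 * (?c * ?d * ?c + - ?s * ?d * ?s) = ?d * (2 * (k\<^sup>2 * ?s\<^sup>2) - k\<^sup>2 * (?s\<^sup>2 + ?c\<^sup>2))"
    by (simp only: power2_eq_square) algebra
  also have "\<dots> = ?d * (2 * (1 - ?d\<^sup>2) - k\<^sup>2)"
    using dn_sq[OF k, of u] by simp
  also have "\<dots> = (2 - k\<^sup>2) * ?d - 2 * ?d ^ 3"
    by (simp add: algebra_simps power2_eq_square power3_eq_cube)
  finally show ?thesis .
qed

text \<open>First integral of the equation of dn: the two factors are
  \<open>k\<^sup>2 sn\<^sup>2\<close> and \<open>k\<^sup>2 cn\<^sup>2\<close>.\<close>

lemma dn_deriv_sq:
  assumes k: "k\<^sup>2 < 1"
  shows "(dn_deriv u k)\<^sup>2 = (1 - (jacobi_dn u k)\<^sup>2) * ((jacobi_dn u k)\<^sup>2 - (1 - k\<^sup>2))"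
proof -
  have "(dn_deriv u k)\<^sup>2 = k\<^sup>2 * (sin (jacobi_am u k))\<^sup>2 * (k\<^sup>2 * (cos (jacobi_am u k))\<^sup>2)"
    by (simp add: dn_deriv_def power2_eq_square)
  also have "\<dots> = (1 - (jacobi_dn u k)\<^sup>2) * ((jacobi_dn u k)\<^sup>2 - (1 - k\<^sup>2))"
    by (simp add: dn_sq[OF k] cos_squared_eq algebra_simps)
  finally show ?thesis .
qed

section \<open>Symmetry, special values and monotonicity of dn\<close>

lemma ellF_minus:
  assumes k: "k\<^sup>2 < 1" shows "ellF (-x) k = - ellF x k"
proof -
  have "ellF x k + ellF (-x) k = ellF 0 k + ellF (-0) k"
    by (rule DERIV_isconst_all[of "\<lambda>x. ellF x k + ellF (-x) k"])
      (auto intro!: derivative_eq_intros DERIV_chain'[of uminus _ _ _ "\<lambda>x. ellF x k"] has_real_derivative_ellF k)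
  then show ?thesis by simp
qed

text \<open>The integrand is symmetric about \<open>pi / 2\<close>, so the sum of
  \<open>ellF\<close> at \<open>x\<close> and at \<open>pi - x\<close> is constant; its value is
  read off at the fixed point \<open>pi / 2\<close>.\<close>

lemma ellF_reflect:
  assumes k: "k\<^sup>2 < 1" shows "ellF (pi - x) k = 2 * ellK k - ellF x k"
proof -
  have "ellF x k + ellF (pi - x) k = ellF (pi/2) k + ellF (pi - pi/2) k"
    by (rule DERIV_isconst_all[of "\<lambda>x. ellF x k + ellF (pi-x) k"])
      (auto intro!: derivative_eq_intros DERIV_chain'[of "\<lambda>x. pi-x" _ _ _ "\<lambda>x. ellF x k"] has_real_derivative_ellF k)
  then show ?thesis by (simp add: ellK_def)
qed

lemma am_minus: "k\<^sup>2 < 1 \<Longrightarrow> jacobi_am (-u) k = - jacobi_am u k"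
  by (rule am_eqI) (auto simp: ellF_minus)

lemma am_reflect: "k\<^sup>2 < 1 \<Longrightarrow> jacobi_am (2 * ellK k - u) k = pi - jacobi_am u k"
  by (rule am_eqI) (auto simp: ellF_reflect)

lemma am_0: "k\<^sup>2 < 1 \<Longrightarrow> jacobi_am 0 k = 0"
  by (rule am_eqI) auto

lemma am_K: "k\<^sup>2 < 1 \<Longrightarrow> jacobi_am (ellK k) k = pi / 2"
  by (rule am_eqI) (auto simp: ellK_def)

lemma dn_minus: "k\<^sup>2 < 1 \<Longrightarrow> jacobi_dn (-u) k = jacobi_dn u k"
  by (simp add: jacobi_dn_def am_minus)

lemma dn_reflect: "k\<^sup>2 < 1 \<Longrightarrow> jacobi_dn (2 * ellK k - u) k = jacobi_dn u k"
  by (simp add: jacobi_dn_def am_reflect)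

lemma dn_deriv_minus: "k\<^sup>2 < 1 \<Longrightarrow> dn_deriv (-u) k = - dn_deriv u k"
  by (simp add: dn_deriv_def am_minus)

lemma am_strict_mono:
  assumes k: "k\<^sup>2 < 1" and "u < v"
  shows "jacobi_am u k < jacobi_am v k"
  by (rule DERIV_pos_imp_increasing[OF \<open>u < v\<close>]) (use has_real_derivative_am[OF k] dn_pos[OF k] in blast)

lemma ellK_pos: assumes "k\<^sup>2 < 1" shows "0 < ellK k"
  using ellF_diff_ge[OF assms, of 0 "pi/2"] pi_gt_zero unfolding ellK_def ellF_0 by linarith

lemma dn_deriv_neg:
  assumes k: "0 < k" "k\<^sup>2 < 1" and u: "0 < u" "u < ellK k"
  shows "dn_deriv u k < 0"
proof -
  have "0 < jacobi_am u k" "jacobi_am u k < pi / 2"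
    using am_strict_mono[OF k(2) u(1)] am_strict_mono[OF k(2) u(2)] am_0[OF k(2)] am_K[OF k(2)] by auto
  then have "0 < sin (jacobi_am u k)" "0 < cos (jacobi_am u k)"
    by (auto intro: sin_gt_zero cos_gt_zero)
  then show ?thesis using k by (simp add: dn_deriv_def)
qed

lemma dn_strict_antimono:
  assumes k: "0 < k" "k\<^sup>2 < 1" and u: "0 \<le> u" "u < v" "v \<le> ellK k"
  shows "jacobi_dn v k < jacobi_dn u k"
proof (rule DERIV_neg_imp_decreasing_open[OF u(2)])
  show "\<exists>y. ((\<lambda>u. jacobi_dn u k) has_real_derivative y) (at x) \<and> y < 0" if "u < x" "x < v" for x
    using that u has_real_derivative_dn[OF k(2)] dn_deriv_neg[OF k, of x] by auto
  show "continuous_on {u..v} (\<lambda>u. jacobi_dn u k)"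
    by (intro continuous_at_imp_continuous_on ballI DERIV_isCont[OF has_real_derivative_dn[OF k(2)]])
qed

lemma dn_0: "k\<^sup>2 < 1 \<Longrightarrow> jacobi_dn 0 k = 1"
  by (simp add: jacobi_dn_def am_0)

lemma dn_K: "k\<^sup>2 < 1 \<Longrightarrow> jacobi_dn (ellK k) k = sqrt (1 - k\<^sup>2)"
  by (simp add: jacobi_dn_def am_K)

lemma dn_deriv_K: "k\<^sup>2 < 1 \<Longrightarrow> dn_deriv (ellK k) k = 0"
  by (simp add: dn_deriv_def am_K)

text \<open>dn decreases strictly from 1 to \<open>sqrt (1 - k\<^sup>2)\<close> on
  \<open>{0..ellK k}\<close>, so the description that defines \<open>jacobi_dn_inv\<close> has
  exactly one solution.\<close>

lemma dn_inv:
  assumes k: "0 < k" "k\<^sup>2 < 1" and y: "sqrt (1 - k\<^sup>2) \<le> y" "y \<le> 1"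
  shows "jacobi_dn_inv y k \<in> {0..ellK k}" "jacobi_dn (jacobi_dn_inv y k) k = y"
proof -
  have "\<exists>u\<ge>0. u \<le> ellK k \<and> jacobi_dn u k = y"
    using y ellK_pos[OF k(2)] DERIV_isCont[OF has_real_derivative_dn[OF k(2)]]
    by (intro IVT2) (simp_all add: dn_0[OF k(2)] dn_K[OF k(2)])
  then obtain u where u: "u \<in> {0..ellK k} \<and> jacobi_dn u k = y" by auto
  have "v = u" if "v \<in> {0..ellK k} \<and> jacobi_dn v k = y" for v
    using that u dn_strict_antimono[OF k, of u v] dn_strict_antimono[OF k, of v u]
    by (cases u v rule: linorder_cases) auto
  with u have "\<exists>!u. u \<in> {0..ellK k} \<and> jacobi_dn u k = y"
    by (rule ex1I)
  from theI'[OF this]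
  show "jacobi_dn_inv y k \<in> {0..ellK k}" "jacobi_dn (jacobi_dn_inv y k) k = y"
    unfolding jacobi_dn_inv_def by auto
qed

section \<open>The profiles\<close>

lemma modulus_sq:
  assumes "\<eta>\<^sup>2 < \<omega>" "0 < \<eta>"
  shows "(modulus \<omega> \<eta>)\<^sup>2 = (2 * \<omega> - 2 * \<eta>\<^sup>2) / (2 * \<omega> - \<eta>\<^sup>2)"
    and "1 - (modulus \<omega> \<eta>)\<^sup>2 = \<eta>\<^sup>2 / (2 * \<omega> - \<eta>\<^sup>2)"
    and "0 < modulus \<omega> \<eta>" "(modulus \<omega> \<eta>)\<^sup>2 < 1"
proof -
  have "0 < \<eta>\<^sup>2" using assms by simp
  then have p: "0 < 2 * \<omega> - \<eta>\<^sup>2" using assms by linarith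
  show 1: "(modulus \<omega> \<eta>)\<^sup>2 = (2 * \<omega> - 2 * \<eta>\<^sup>2) / (2 * \<omega> - \<eta>\<^sup>2)"
    unfolding modulus_def using p assms by (intro real_sqrt_pow2 divide_nonneg_pos) auto
  show 2: "1 - (modulus \<omega> \<eta>)\<^sup>2 = \<eta>\<^sup>2 / (2 * \<omega> - \<eta>\<^sup>2)"
    unfolding 1 using p by (simp add: field_simps)
  show "0 < modulus \<omega> \<eta>"
    unfolding modulus_def using p assms by simp
  have "0 < \<eta>\<^sup>2 / (2 * \<omega> - \<eta>\<^sup>2)"
    using p \<open>0 < \<eta>\<^sup>2\<close> by (rule divide_pos_pos[rotated])
  then show "(modulus \<omega> \<eta>)\<^sup>2 < 1" using 2 by linarith
qed

text \<open>Smooth on the whole line, without the absolute value and the periodic extension in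
  \<open>profile\<close>. The free phase \<open>s\<close> will be \<open>0\<close> for
  \<open>Z = 0\<close> and \<open>sgn Z * shift \<omega> Z \<eta>\<close> otherwise.\<close>

definition wave :: "real \<Rightarrow> real \<Rightarrow> real \<Rightarrow> real \<Rightarrow> real" where
  "wave \<omega> \<eta> s x = sqrt (2 * \<omega> - \<eta>\<^sup>2) *
     jacobi_dn (sqrt (2 * \<omega> - \<eta>\<^sup>2) / sqrt 2 * x + s) (modulus \<omega> \<eta>)"

definition wave_deriv :: "real \<Rightarrow> real \<Rightarrow> real \<Rightarrow> real \<Rightarrow> real" where
  "wave_deriv \<omega> \<eta> s x = (2 * \<omega> - \<eta>\<^sup>2) / sqrt 2 *
     dn_deriv (sqrt (2 * \<omega> - \<eta>\<^sup>2) / sqrt 2 * x + s) (modulus \<omega> \<eta>)"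

section \<open>Differential equation, energy and symmetry of the dn wave\<close>

context
  fixes \<omega> \<eta> :: real
  assumes \<eta>: "0 < \<eta>" "\<eta>\<^sup>2 < \<omega>"
begin

lemma eta1_sq_pos: "0 < 2 * \<omega> - \<eta>\<^sup>2"
  using \<eta> zero_less_power[OF \<eta>(1), of 2] by linarith

lemma has_real_derivative_arg:
  fixes c s :: real
  shows "((\<lambda>x. c * x + s) has_real_derivative c) (at x)"
  by (rule derivative_eq_intros refl)+ simp

lemma has_real_derivative_wave:
  "(wave \<omega> \<eta> s has_real_derivative wave_deriv \<omega> \<eta> s x) (at x)"
proof -
  let ?e = "sqrt (2 * \<omega> - \<eta>\<^sup>2)"
  have "((\<lambda>x. jacobi_dn (?e / sqrt 2 * x + s) (modulus \<omega> \<eta>)) has_real_derivative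
      dn_deriv (?e / sqrt 2 * x + s) (modulus \<omega> \<eta>) * (?e / sqrt 2)) (at x)"
    by (rule DERIV_chain2[OF has_real_derivative_dn[OF modulus_sq(4)[OF \<eta>(2,1)]] has_real_derivative_arg])
  from DERIV_cmult[OF this, of ?e]
  have "(wave \<omega> \<eta> s has_real_derivative
      ?e * (dn_deriv (?e / sqrt 2 * x + s) (modulus \<omega> \<eta>) * (?e / sqrt 2))) (at x)"
    by (simp only: wave_def[abs_def])
  also have "?e * (dn_deriv (?e / sqrt 2 * x + s) (modulus \<omega> \<eta>) * (?e / sqrt 2)) =
      ?e\<^sup>2 / sqrt 2 * dn_deriv (?e / sqrt 2 * x + s) (modulus \<omega> \<eta>)"
    by (simp only: power2_eq_square times_divide_eq_right times_divide_eq_left mult_ac)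
  also have "?e\<^sup>2 = 2 * \<omega> - \<eta>\<^sup>2" using eta1_sq_pos by simp
  finally show ?thesis by (simp only: wave_deriv_def)
qed

lemma has_real_derivative_wave_deriv:
  "(wave_deriv \<omega> \<eta> s has_real_derivative \<omega> * wave \<omega> \<eta> s x - (wave \<omega> \<eta> s x)^3) (at x)"
proof -
  let ?e = "sqrt (2 * \<omega> - \<eta>\<^sup>2)" and ?k = "modulus \<omega> \<eta>"
  let ?D = "jacobi_dn (?e / sqrt 2 * x + s) ?k"
  have e: "?e\<^sup>2 = 2 * \<omega> - \<eta>\<^sup>2" using eta1_sq_pos by simp
  have k: "?e\<^sup>2 * ?k\<^sup>2 = 2 * \<omega> - 2 * \<eta>\<^sup>2" unfolding e using modulus_sq(1)[OF \<eta>(2,1)] eta1_sq_pos by simp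
  have "((\<lambda>x. dn_deriv (?e / sqrt 2 * x + s) ?k) has_real_derivative
      ((2 - ?k\<^sup>2) * ?D - 2 * ?D^3) * (?e / sqrt 2)) (at x)"
    by (rule DERIV_chain2[OF has_real_derivative_dn_deriv[OF modulus_sq(4)[OF \<eta>(2,1)]] has_real_derivative_arg])
  from DERIV_cmult[OF this, of "?e\<^sup>2 / sqrt 2"]
  have "(wave_deriv \<omega> \<eta> s has_real_derivative ?e\<^sup>2 / sqrt 2 * (((2 - ?k\<^sup>2) * ?D - 2 * ?D^3) * (?e / sqrt 2))) (at x)"
    by (simp add: wave_deriv_def[abs_def] e)
  also have "?e\<^sup>2 / sqrt 2 * (((2 - ?k\<^sup>2) * ?D - 2 * ?D^3) * (?e / sqrt 2))
      = (2 * ?e\<^sup>2 - ?e\<^sup>2 * ?k\<^sup>2) / 2 * (?e * ?D) - ?e ^ 3 * ?D ^ 3"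
    by (simp add: field_simps power2_eq_square power3_eq_cube)
  also have "\<dots> = \<omega> * wave \<omega> \<eta> s x - (wave \<omega> \<eta> s x)^3"
  proof -
    have "(2 * ?e\<^sup>2 - ?e\<^sup>2 * ?k\<^sup>2) / 2 = \<omega>" by (subst k, subst e) simp
    then show ?thesis unfolding wave_def power_mult_distrib by (simp only:)
  qed
  finally show ?thesis .
qed

text \<open>The rescaled first integral of dn, since \<open>\<eta>\<^sup>2 = (2 * \<omega> -
  \<eta>\<^sup>2) * (1 - k\<^sup>2)\<close>. It will turn the algebraic definition of
  \<open>Phi\<close> into a statement about the slope at 0.\<close>

lemma wave_energy:
  "(wave_deriv \<omega> \<eta> s x)\<^sup>2 = ((2 * \<omega> - \<eta>\<^sup>2) - (wave \<omega> \<eta> s x)\<^sup>2) * ((wave \<omega> \<eta> s x)\<^sup>2 - \<eta>\<^sup>2) / 2"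
proof -
  let ?e = "2 * \<omega> - \<eta>\<^sup>2" and ?k = "modulus \<omega> \<eta>"
  let ?D = "jacobi_dn (sqrt ?e / sqrt 2 * x + s) ?k"
  have "\<eta>\<^sup>2 = ?e * (1 - ?k\<^sup>2)" using modulus_sq(2)[OF \<eta>(2,1)] eta1_sq_pos by simp
  then have "(?e - ?e * ?D\<^sup>2) * (?e * ?D\<^sup>2 - \<eta>\<^sup>2) / 2 = ?e\<^sup>2 / 2 * ((1 - ?D\<^sup>2) * (?D\<^sup>2 - (1 - ?k\<^sup>2)))"
    by algebra
  also have "\<dots> = (wave_deriv \<omega> \<eta> s x)\<^sup>2"
    unfolding wave_deriv_def power_mult_distrib power_divide dn_deriv_sq[OF modulus_sq(4)[OF \<eta>(2,1)]] by simp
  finally show ?thesis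
    using eta1_sq_pos by (simp add: wave_def power_mult_distrib)
qed

lemma wave_pos: "0 < wave \<omega> \<eta> s x"
  unfolding wave_def using eta1_sq_pos modulus_sq[OF \<eta>(2,1)] by (intro mult_pos_pos dn_pos) auto

lemma wave_sq_le: "(wave \<omega> \<eta> s x)\<^sup>2 \<le> 2 * \<omega>"
proof -
  have k: "(modulus \<omega> \<eta>)\<^sup>2 < 1" using modulus_sq[OF \<eta>(2,1)] by simp
  have "(wave \<omega> \<eta> s x)\<^sup>2 \<le> (2 * \<omega> - \<eta>\<^sup>2) * 1"
    unfolding wave_def power_mult_distrib using eta1_sq_pos dn_sq[OF k] by (auto intro!: mult_left_mono)
  then show ?thesis by (smt (verit) zero_le_power2)
qed

context
  fixes L s :: real
  assumes period: "sqrt (2 * \<omega> - \<eta>\<^sup>2) / sqrt 2 * L + s = ellK (modulus \<omega> \<eta>)"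
begin

text \<open>The period equation says that the argument of dn reaches \<open>ellK\<close> at
  \<open>x = L\<close>. Reflecting \<open>x\<close> about \<open>L\<close> therefore reflects the
  argument about \<open>ellK\<close>, a point of symmetry of dn.\<close>

lemma wave_arg_reflect:
  "sqrt (2 * \<omega> - \<eta>\<^sup>2) / sqrt 2 * (2 * L - x) + s =
     2 * ellK (modulus \<omega> \<eta>) - (sqrt (2 * \<omega> - \<eta>\<^sup>2) / sqrt 2 * x + s)"
  by (simp add: period[symmetric] right_diff_distrib)

lemma wave_reflect: "wave \<omega> \<eta> s (2 * L - x) = wave \<omega> \<eta> s x"
  unfolding wave_def wave_arg_reflect using modulus_sq[OF \<eta>(2,1)] by (simp add: dn_reflect)

lemma wave_L: "wave \<omega> \<eta> s L = \<eta>"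
  using modulus_sq[OF \<eta>(2,1)] eta1_sq_pos \<eta> unfolding wave_def period
  by (simp add: dn_K real_sqrt_divide)

lemma wave_deriv_L: "wave_deriv \<omega> \<eta> s L = 0"
  using modulus_sq[OF \<eta>(2,1)] unfolding wave_deriv_def period by (simp add: dn_deriv_K)

end

lemma modulus_lt_1: "(modulus \<omega> \<eta>)\<^sup>2 < 1"
  using modulus_sq[OF \<eta>(2,1)] by simp

lemma wave_minus: "wave \<omega> \<eta> 0 (-x) = wave \<omega> \<eta> 0 x"
  using dn_minus[OF modulus_lt_1, of "sqrt (2 * \<omega> - \<eta>\<^sup>2) / sqrt 2 * x"] by (simp add: wave_def)

lemma wave_deriv_0: "wave_deriv \<omega> \<eta> 0 0 = 0"
  by (simp add: wave_deriv_def dn_deriv_def am_0 modulus_lt_1)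

end

text \<open>\<open>Phi\<^sup>2\<close> is the larger root \<open>y\<close> of
  \<open>(q - y) * (y - \<eta>\<^sup>2) = Z\<^sup>2 / 2 * y\<close> with
  \<open>q = 2 * \<omega> - \<eta>\<^sup>2\<close>. By the energy identity a wave at height
  \<open>Phi\<close> then has slope of modulus \<open>\<bar>Z\<bar> / 2 * Phi\<close>, as the jump
  condition asks. The upper bound on \<open>\<eta>\<close> makes the roots real and puts
  \<open>Phi\<close> into the range of the wave.\<close>

lemma Phi_bounds:
  assumes \<eta>: "0 < \<eta>" "\<eta> < - (sqrt 2 / 4) * \<bar>Z\<bar> + sqrt (\<omega> - Z\<^sup>2 / 8)"
  shows "\<eta>\<^sup>2 < \<omega>" "0 < Phi \<omega> Z \<eta>"
    "((2 * \<omega> - \<eta>\<^sup>2) - (Phi \<omega> Z \<eta>)\<^sup>2) * ((Phi \<omega> Z \<eta>)\<^sup>2 - \<eta>\<^sup>2) / 2 = Z\<^sup>2 / 4 * (Phi \<omega> Z \<eta>)\<^sup>2"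
    "\<eta> \<le> Phi \<omega> Z \<eta>" "Phi \<omega> Z \<eta> \<le> sqrt (2 * \<omega> - \<eta>\<^sup>2)"
proof -
  \<comment> \<open>Scaled so that \<open>e\<^sup>2 = Z\<^sup>2 / 8\<close>; the upper bound on
    \<open>\<eta>\<close> becomes \<open>\<eta> + e < sqrt (\<omega> - e\<^sup>2)\<close>.\<close>
  define e where "e = sqrt 2 / 4 * \<bar>Z\<bar>"
  \<comment> \<open>\<open>2 * m\<close> is the sum of the two roots.\<close>
  define m where "m = \<omega> - 2 * e\<^sup>2"
  have e: "0 \<le> e" "Z\<^sup>2 = 8 * e\<^sup>2" by (auto simp: e_def power_mult_distrib power_divide)
  have lt: "\<eta> + e < sqrt (\<omega> - e\<^sup>2)" using \<eta>(2) e by (simp add: e_def)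
  have "0 < sqrt (\<omega> - e\<^sup>2)" using lt e \<eta> by linarith
  then have "0 < \<omega> - e\<^sup>2" by simp
  then have "(\<eta> + e)\<^sup>2 < \<omega> - e\<^sup>2"
    using power_strict_mono[OF lt, of 2] e \<eta> by simp
  then have gap: "2 * e * \<eta> < m - \<eta>\<^sup>2" by (simp add: m_def power2_eq_square algebra_simps)
  moreover have "0 \<le> 2 * e * \<eta>" using e \<eta> by simp
  ultimately have m: "0 < m - \<eta>\<^sup>2" by linarith
  then show 1: "\<eta>\<^sup>2 < \<omega>" unfolding m_def using zero_le_power2[of e] by linarith
  define q where "q = 2 * \<omega> - \<eta>\<^sup>2"
  have "\<eta>\<^sup>2 * q \<le> m\<^sup>2"
  proof -
    \<comment> \<open>The difference of these two squares is exactly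
      \<open>m\<^sup>2 - \<eta>\<^sup>2 * q\<close>, a quarter of the discriminant.\<close>
    have "(2 * e * \<eta>)\<^sup>2 \<le> (m - \<eta>\<^sup>2)\<^sup>2"
      using gap \<open>0 \<le> 2 * e * \<eta>\<close> by (intro power_mono) auto
    then show ?thesis by (simp add: q_def m_def power2_eq_square algebra_simps)
  qed
  define r where "r = sqrt ((2 * m)\<^sup>2 - 4 * \<eta>\<^sup>2 * q)"
  have r: "r\<^sup>2 = 4 * m\<^sup>2 - 4 * \<eta>\<^sup>2 * q" "0 \<le> r"
    using \<open>\<eta>\<^sup>2 * q \<le> m\<^sup>2\<close> by (auto simp: r_def power_mult_distrib)
  have "m > 0" using m zero_le_power2[of \<eta>] by linarith
  have Phi: "Phi \<omega> Z \<eta> = sqrt (m + r / 2)"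
    by (simp add: Phi_def r_def q_def m_def e algebra_simps)
  then show 2: "0 < Phi \<omega> Z \<eta>" using \<open>m > 0\<close> r by simp
  define y where "y = (Phi \<omega> Z \<eta>)\<^sup>2"
  have y: "y = m + r / 2" using Phi \<open>m > 0\<close> r by (simp add: y_def)
  have "(y - m)\<^sup>2 = m\<^sup>2 - \<eta>\<^sup>2 * q" using r by (simp add: y power_divide)
  then have quad: "(q - y) * (y - \<eta>\<^sup>2) = 4 * e\<^sup>2 * y"
    by (simp add: q_def m_def power2_eq_square algebra_simps)
  then show "((2 * \<omega> - \<eta>\<^sup>2) - (Phi \<omega> Z \<eta>)\<^sup>2) * ((Phi \<omega> Z \<eta>)\<^sup>2 - \<eta>\<^sup>2) / 2 = Z\<^sup>2 / 4 * (Phi \<omega> Z \<eta>)\<^sup>2"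
    by (simp add: e q_def y_def)
  have "\<eta>\<^sup>2 < y" using m r by (simp add: y)
  then show "\<eta> \<le> Phi \<omega> Z \<eta>" unfolding y_def using 2 power2_le_imp_le[of \<eta> "Phi \<omega> Z \<eta>"] by simp
  have "0 \<le> (q - y) * (y - \<eta>\<^sup>2)" unfolding quad using 2 by (simp add: y_def)
  then have "y \<le> q" using \<open>\<eta>\<^sup>2 < y\<close> by (simp add: zero_le_mult_iff)
  then show "Phi \<omega> Z \<eta> \<le> sqrt (2 * \<omega> - \<eta>\<^sup>2)"
    unfolding y_def q_def by (rule real_le_rsqrt)
qed


text \<open>The interface between the elliptic functions and the analysis of the operator. Agreement
  with \<open>\<phi>\<close> is asked for only on the open interval because \<open>\<phi>\<close>
  has a corner at 0 when \<open>Z \<noteq> 0\<close>, while \<open>\<Psi>\<close> is smooth there.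
  \<open>deriv_0\<close> is half of the jump condition at the defect.\<close>

locale stationary_wave =
  fixes L \<omega> Z :: real and \<phi> \<Psi> \<Psi>' :: "real \<Rightarrow> real"
  assumes deriv_wave: "\<And>x. (\<Psi> has_real_derivative \<Psi>' x) (at x)"
    and deriv2_wave: "\<And>x. (\<Psi>' has_real_derivative \<omega> * \<Psi> x - (\<Psi> x)^3) (at x)"
    and pos: "\<And>x. 0 < \<Psi> x" and sq_le: "\<And>x. (\<Psi> x)\<^sup>2 \<le> 2 * \<omega>"
    and reflect: "\<And>x. \<Psi> (2 * L - x) = \<Psi> x"
    and deriv_L: "\<Psi>' L = 0" and deriv_0: "\<Psi>' 0 = - (Z / 2) * \<Psi> 0"
    and profile_eq: "\<And>x. 0 < x \<Longrightarrow> x < 2 * L \<Longrightarrow> \<phi> x = \<Psi> x"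

section \<open>Verification that the given profiles are stationary waves\<close>

lemma stationary_wave_wave:
  assumes \<eta>: "0 < \<eta>" "\<eta>\<^sup>2 < \<omega>"
    and period: "sqrt (2 * \<omega> - \<eta>\<^sup>2) / sqrt 2 * L + s = ellK (modulus \<omega> \<eta>)"
    and "wave_deriv \<omega> \<eta> s 0 = - (Z / 2) * wave \<omega> \<eta> s 0"
    and "\<And>x. 0 < x \<Longrightarrow> x < 2 * L \<Longrightarrow> \<phi> x = wave \<omega> \<eta> s x"
  shows "stationary_wave L \<omega> Z \<phi> (wave \<omega> \<eta> s) (wave_deriv \<omega> \<eta> s)"
  using assms(4,5)
  by unfold_locales (auto simp: has_real_derivative_wave[OF \<eta>] has_real_derivative_wave_deriv[OF \<eta>]
      wave_pos[OF \<eta>] wave_sq_le[OF \<eta>] wave_reflect[OF \<eta> period] wave_deriv_L[OF \<eta> period])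

lemma eta2_0_bounds:
  assumes "eta2_branch L \<omega> Z0 \<eta>\<^sub>2" "0 < \<omega>"
  shows "0 < \<eta>\<^sub>2 0" "(\<eta>\<^sub>2 0)\<^sup>2 < \<omega>"
proof -
  show "0 < \<eta>\<^sub>2 0" using assms by (auto simp: eta2_branch_def)
  have "\<eta>\<^sub>2 0 < sqrt \<omega>" using assms by (auto simp: eta2_branch_def)
  from power_strict_mono[OF this, of 2] show "(\<eta>\<^sub>2 0)\<^sup>2 < \<omega>" using \<open>0 < \<eta>\<^sub>2 0\<close> assms by simp
qed

lemma half_period_eq:
  fixes e K s L :: real
  assumes "0 < e" "2 * sqrt 2 / e * (K - s) = 2 * L"
  shows "e / sqrt 2 * L + s = K"
proof -
  have "sqrt 2 * (K - s) = L * e" using assms by (simp add: field_simps)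
  then have "e / sqrt 2 * L = sqrt 2 * (K - s) / sqrt 2" by (simp add: mult.commute)
  then show ?thesis by simp
qed

lemma period_0:
  assumes "eta2_branch L \<omega> Z0 \<eta>\<^sub>2" "0 < \<omega>"
  shows "sqrt (2 * \<omega> - (\<eta>\<^sub>2 0)\<^sup>2) / sqrt 2 * L + 0 = ellK (modulus \<omega> (\<eta>\<^sub>2 0))"
  using assms eta1_sq_pos[OF eta2_0_bounds[OF assms]]
  by (intro half_period_eq) (auto simp: eta2_branch_def)

lemma profile_0: "profile L \<omega> \<eta>\<^sub>2 0 = wave \<omega> (\<eta>\<^sub>2 0) 0"
  by (auto simp: profile_def wave_def Let_def)

lemma stationary_wave_0:
  assumes "eta2_branch L \<omega> Z0 \<eta>\<^sub>2" "0 < \<omega>"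
  shows "stationary_wave L \<omega> 0 (profile L \<omega> \<eta>\<^sub>2 0) (wave \<omega> (\<eta>\<^sub>2 0) 0) (wave_deriv \<omega> (\<eta>\<^sub>2 0) 0)"
  using eta2_0_bounds[OF assms] period_0[OF assms]
  by (intro stationary_wave_wave) (auto simp: profile_0 wave_deriv_0)

text \<open>The value of the wave at 0 is \<open>Phi\<close>, so the energy identity gives the
  modulus of the slope there. Its sign comes from dn decreasing on \<open>{0..ellK k}\<close>
  together with the sign of the phase.\<close>

lemma stationary_wave_nonzero:
  assumes br: "eta2_branch L \<omega> Z0 \<eta>\<^sub>2" and "0 < L" and Z: "Z \<in> {-Z0<..<Z0}" "Z \<noteq> 0"
  defines "s \<equiv> sgn Z * shift \<omega> Z (\<eta>\<^sub>2 Z)"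
  shows "stationary_wave L \<omega> Z (profile L \<omega> \<eta>\<^sub>2 Z) (wave \<omega> (\<eta>\<^sub>2 Z) s) (wave_deriv \<omega> (\<eta>\<^sub>2 Z) s)"
    and "wave \<omega> (\<eta>\<^sub>2 Z) s L = \<eta>\<^sub>2 Z"
proof -
  define \<eta> where "\<eta> = \<eta>\<^sub>2 Z"
  define a where "a = shift \<omega> Z \<eta>"
  define k where "k = modulus \<omega> \<eta>"
  define e where "e = sqrt (2 * \<omega> - \<eta>\<^sup>2)"
  have bounds: "0 < \<eta>" "\<eta> < - (sqrt 2 / 4) * \<bar>Z\<bar> + sqrt (\<omega> - Z\<^sup>2 / 8)"
    and per: "2 * sqrt 2 / e * (ellK k - s) = 2 * L"
    using br Z by (auto simp: eta2_branch_def \<eta>_def s_def k_def e_def)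
  note Phi = Phi_bounds[OF bounds]
  note \<eta> = bounds(1) Phi(1)
  have e: "0 < e" using eta1_sq_pos[OF \<eta>] by (simp add: e_def)
  have s: "s = sgn Z * a" by (simp add: s_def a_def \<eta>_def)
  have period: "sqrt (2 * \<omega> - \<eta>\<^sup>2) / sqrt 2 * L + s = ellK (modulus \<omega> \<eta>)"
    using half_period_eq[OF e per] by (simp add: e_def k_def)
  have k: "0 < k" "k\<^sup>2 < 1" "sqrt (1 - k\<^sup>2) = \<eta> / e"
    using modulus_sq[OF \<eta>(2,1)] \<eta> by (auto simp: k_def e_def real_sqrt_divide)
  have "sqrt (1 - k\<^sup>2) \<le> Phi \<omega> Z \<eta> / e" "Phi \<omega> Z \<eta> / e \<le> 1"
    using Phi e k by (auto simp: e_def divide_right_mono)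
  from dn_inv[OF k(1,2) this] have a: "0 \<le> a" "a \<le> ellK k" "jacobi_dn a k = Phi \<omega> Z \<eta> / e"
    by (auto simp: a_def shift_def k_def e_def)
  have sgn: "sgn Z = 1 \<or> sgn Z = -1" using Z by (auto simp: sgn_if)
  then have dn_s: "jacobi_dn s k = Phi \<omega> Z \<eta> / e" "dn_deriv s k = sgn Z * dn_deriv a k"
    using a k by (auto simp: s dn_minus dn_deriv_minus)
  have wave0: "wave \<omega> \<eta> s 0 = Phi \<omega> Z \<eta>"
    using dn_s e by (simp add: wave_def k_def[symmetric] e_def)
  have "dn_deriv a k \<le> 0"
    using a dn_deriv_neg[OF k(1,2), of a] dn_deriv_K[OF k(2)]
    by (cases "a = 0 \<or> a = ellK k") (auto simp: dn_deriv_def am_0 k)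
  \<comment> \<open>The energy identity gives only the square of the slope; the factor
    \<open>- sgn Z\<close> makes \<open>t\<close> nonnegative, so that the root can be
    taken.\<close>
  define t where "t = - sgn Z * wave_deriv \<omega> \<eta> s 0"
  have "t = - (sgn Z)\<^sup>2 * ((2 * \<omega> - \<eta>\<^sup>2) / sqrt 2) * dn_deriv a k"
    by (simp add: t_def wave_deriv_def dn_s(2) k_def[symmetric] power2_eq_square)
  also have "(sgn Z)\<^sup>2 = 1" using sgn by auto
  finally have "0 \<le> t" using \<open>dn_deriv a k \<le> 0\<close> eta1_sq_pos[OF \<eta>]
    by (simp add: mult_nonpos_nonpos)
  have "t\<^sup>2 = (wave_deriv \<omega> \<eta> s 0)\<^sup>2" using sgn by (auto simp: t_def)
  also have "\<dots> = (\<bar>Z\<bar> / 2 * Phi \<omega> Z \<eta>)\<^sup>2"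
    unfolding wave_energy[OF \<eta>] wave0 Phi(3) by (simp add: power_mult_distrib power_divide)
  finally have "t = \<bar>Z\<bar> / 2 * Phi \<omega> Z \<eta>"
    using \<open>0 \<le> t\<close> Phi(2) by (simp add: power2_eq_iff_nonneg)
  then have jump: "wave_deriv \<omega> \<eta> s 0 = - (Z / 2) * wave \<omega> \<eta> s 0"
    using sgn Z unfolding t_def wave0 by (auto simp: sgn_if split: if_splits)
  have eq: "profile L \<omega> \<eta>\<^sub>2 Z x = wave \<omega> \<eta> s x" if x: "0 < x" "x < 2 * L" for x
  proof (cases "x < L")
    case True
    then have "\<lfloor>(x + L) / (2 * L)\<rfloor> = 0" using x by (intro floor_eq_iff[THEN iffD2]) auto
    then show ?thesis using x Z
      by (simp add: profile_def periodic_extension_def wave_def Let_def \<eta>_def s_def)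
  next
    \<comment> \<open>From \<open>L\<close> on, the periodic extension evaluates the formula at
      \<open>x - 2 * L\<close>, whose modulus is \<open>2 * L - x\<close>; the symmetry about
      \<open>L\<close> leads back to \<open>x\<close>.\<close>
    case False
    then have "\<lfloor>(x + L) / (2 * L)\<rfloor> = 1" using x \<open>0 < L\<close>
      by (intro floor_eq_iff[THEN iffD2]) (auto simp: field_simps)
    then have "profile L \<omega> \<eta>\<^sub>2 Z x = wave \<omega> \<eta> s (2 * L - x)" using x Z
      by (simp add: profile_def periodic_extension_def wave_def Let_def \<eta>_def s_def)
    then show ?thesis using wave_reflect[OF \<eta> period] by simp
  qed
  show "stationary_wave L \<omega> Z (profile L \<omega> \<eta>\<^sub>2 Z) (wave \<omega> (\<eta>\<^sub>2 Z) s) (wave_deriv \<omega> (\<eta>\<^sub>2 Z) s)"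
    using stationary_wave_wave[OF \<eta> period jump eq] by (simp add: \<eta>_def)
  show "wave \<omega> (\<eta>\<^sub>2 Z) s L = \<eta>\<^sub>2 Z" using wave_L[OF \<eta> period] by (simp add: \<eta>_def)
qed

section \<open>Second order linear equations\<close>

text \<open>The integrating factor \<open>exp (c * x)\<close> makes
  \<open>exp (c * x) * (E x + m / c)\<close> nondecreasing, so it is bounded by its value at
  \<open>L\<close>.\<close>

lemma gronwall_backwards:
  fixes E E' :: "real \<Rightarrow> real"
  assumes cont: "continuous_on {0..L} E"
    and deriv: "\<And>x. 0 < x \<Longrightarrow> x < L \<Longrightarrow> (E has_real_derivative E' x) (at x)"
    and ge: "\<And>x. 0 < x \<Longrightarrow> x < L \<Longrightarrow> - c * E x - m \<le> E' x"
    and "0 < c" "0 \<le> m" "0 \<le> E L" and x: "x \<in> {0..L}"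
  shows "E x \<le> (E L + m / c) * exp (c * L)"
proof -
  let ?G = "\<lambda>x. exp (c * x) * (E x + m / c)"
  have "?G x \<le> ?G L"
  proof (rule DERIV_nonneg_imp_increasing_open[of x L ?G])
    show "x \<le> L" using x by simp
    show "continuous_on {x..L} ?G"
      using x by (intro continuous_intros continuous_on_subset[OF cont]) auto
    fix t assume t: "x < t" "t < L"
    then have t': "0 < t" "t < L" using x by auto
    have "(?G has_real_derivative exp (c * t) * (c * E t + m + E' t)) (at t)"
      using \<open>0 < c\<close> by (auto intro!: derivative_eq_intros deriv t' simp: algebra_simps)
    moreover have "0 \<le> exp (c * t) * (c * E t + m + E' t)"
      using ge[OF t'] by simp
    ultimately show "\<exists>y. (?G has_real_derivative y) (at t) \<and> 0 \<le> y" by blast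
  qed
  also have "\<dots> \<le> exp (c * x) * ((E L + m / c) * exp (c * L))"
  proof -
    have "exp (c * L) \<le> exp (c * x) * exp (c * L)" using x \<open>0 < c\<close> by simp
    from mult_right_mono[OF this, of "E L + m / c"] show ?thesis
      using assms by (simp add: mult_ac)
  qed
  finally have "E x + m / c \<le> (E L + m / c) * exp (c * L)" by simp
  then show ?thesis using \<open>0 < c\<close> \<open>0 \<le> m\<close> divide_nonneg_pos[of m c] by linarith
qed

text \<open>Gronwall for the energy \<open>d\<^sup>2 + d'\<^sup>2\<close>. Of the rate
  \<open>K + 2\<close>, the part \<open>K\<close> comes from the potential, one unit from
  \<open>2 * d * d'\<close> and one from the forcing \<open>r\<close>, each by
  \<open>2ab \<le> a\<^sup>2 + b\<^sup>2\<close>.\<close>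

lemma second_order_bound:
  fixes d d' q r :: "real \<Rightarrow> real"
  assumes cont: "continuous_on {0..L} d" "continuous_on {0..L} d'"
    and deriv: "\<And>x. 0 < x \<Longrightarrow> x < L \<Longrightarrow> (d has_real_derivative d' x) (at x)"
    and deriv2: "\<And>x. 0 < x \<Longrightarrow> x < L \<Longrightarrow> (d' has_real_derivative q x * d x + r x) (at x)"
    and q: "\<And>x. 0 < x \<Longrightarrow> x < L \<Longrightarrow> \<bar>q x\<bar> \<le> K"
    and r: "\<And>x. 0 < x \<Longrightarrow> x < L \<Longrightarrow> \<bar>r x\<bar> \<le> \<epsilon>"
    and "0 \<le> K" "x \<in> {0..L}"
  shows "(d x)\<^sup>2 + (d' x)\<^sup>2 \<le> ((d L)\<^sup>2 + (d' L)\<^sup>2 + \<epsilon>\<^sup>2) * exp ((K + 2) * L)"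
proof -
  let ?E = "\<lambda>x. (d x)\<^sup>2 + (d' x)\<^sup>2"
  have "?E x \<le> (?E L + \<epsilon>\<^sup>2 / (K + 2)) * exp ((K + 2) * L)"
  proof (rule gronwall_backwards)
    show "continuous_on {0..L} ?E" by (intro continuous_intros cont)
    fix t assume t: "0 < t" "t < L"
    let ?D = "2 * d t * d' t + 2 * d' t * (q t * d t + r t)"
    show "(?E has_real_derivative ?D) (at t)"
      by (auto intro!: derivative_eq_intros deriv deriv2 t)
    have "- ((d t)\<^sup>2 + (d' t)\<^sup>2) \<le> 2 * d t * d' t"
      using zero_le_power2[of "d t + d' t"] by (simp add: power2_sum)
    moreover have "- (K * ?E t) \<le> q t * (2 * d' t * d t)"
    proof -
      have "\<bar>2 * d' t * d t\<bar> \<le> ?E t"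
        using sum_squares_bound[of "\<bar>d t\<bar>" "\<bar>d' t\<bar>"] by (simp add: abs_mult mult_ac)
      then have "\<bar>q t\<bar> * \<bar>2 * d' t * d t\<bar> \<le> K * ?E t"
        using q[OF t] by (intro mult_mono) auto
      then show ?thesis unfolding abs_mult[symmetric] by linarith
    qed
    moreover have "- ((d' t)\<^sup>2 + \<epsilon>\<^sup>2) \<le> 2 * d' t * r t"
    proof -
      have "(r t)\<^sup>2 \<le> \<epsilon>\<^sup>2" using r[OF t] abs_le_square_iff[of "r t" \<epsilon>] by linarith
      then show ?thesis using zero_le_power2[of "d' t + r t"] by (simp add: power2_sum)
    qed
    moreover have "?D = 2 * d t * d' t + q t * (2 * d' t * d t) + 2 * d' t * r t"
      by (simp add: algebra_simps)
    moreover have "- (K + 2) * ?E t = - ?E t - K * ?E t - (d' t)\<^sup>2 - (d t)\<^sup>2"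
      by (simp add: algebra_simps)
    ultimately show "- (K + 2) * ?E t - \<epsilon>\<^sup>2 \<le> ?D"
      using zero_le_power2[of "d t"] by linarith
  qed (use assms in auto)
  also have "\<dots> \<le> (?E L + \<epsilon>\<^sup>2) * exp ((K + 2) * L)"
  proof -
    have "\<epsilon>\<^sup>2 * 1 \<le> \<epsilon>\<^sup>2 * (K + 2)" using \<open>0 \<le> K\<close> by (intro mult_left_mono) auto
    then have "\<epsilon>\<^sup>2 / (K + 2) \<le> \<epsilon>\<^sup>2" using \<open>0 \<le> K\<close> by (simp add: divide_le_eq)
    then show ?thesis by (intro mult_right_mono) auto
  qed
  finally show ?thesis .
qed

text \<open>The equation is imposed on the open interval only, with \<open>y'\<close> extended
  continuously to the endpoints: at the defect an eigenfunction has just one-sided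
  derivatives.\<close>

definition ode_sol :: "real \<Rightarrow> (real \<Rightarrow> real) \<Rightarrow> (real \<Rightarrow> real) \<Rightarrow> (real \<Rightarrow> real) \<Rightarrow> bool" where
  "ode_sol L q y y' \<longleftrightarrow> continuous_on {0..L} y \<and> continuous_on {0..L} y' \<and>
     (\<forall>x. 0 < x \<and> x < L \<longrightarrow>
        (y has_real_derivative y' x) (at x) \<and> (y' has_real_derivative q x * y x) (at x))"

text \<open>The difference of the solutions satisfies the equation with potential \<open>q\<close>
  and forcing \<open>(q - q0) * y0\<close>, with zero data at \<open>L\<close>. Since
  \<open>\<epsilon> \<le> 1\<close>, \<open>K + 1\<close> bounds \<open>q\<close>.\<close>

lemma ode_sol_perturb:
  assumes y: "ode_sol L q y y'" and y0: "ode_sol L q0 y0 y0'"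
    and data: "y L = y0 L" "y' L = y0' L"
    and K: "\<And>x. x \<in> {0..L} \<Longrightarrow> \<bar>q0 x\<bar> \<le> K" "0 \<le> K"
    and \<epsilon>: "\<And>x. x \<in> {0..L} \<Longrightarrow> \<bar>q x - q0 x\<bar> \<le> \<epsilon>" "\<epsilon> \<le> 1"
    and M: "\<And>x. x \<in> {0..L} \<Longrightarrow> \<bar>y0 x\<bar> \<le> M" and x: "x \<in> {0..L}"
  shows "(y x - y0 x)\<^sup>2 + (y' x - y0' x)\<^sup>2 \<le> (\<epsilon> * M)\<^sup>2 * exp ((K + 3) * L)"
proof -
  have "(y x - y0 x)\<^sup>2 + (y' x - y0' x)\<^sup>2
      \<le> ((y L - y0 L)\<^sup>2 + (y' L - y0' L)\<^sup>2 + (\<epsilon> * M)\<^sup>2) * exp (((K + 1) + 2) * L)"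
  proof (rule second_order_bound[where q = q and r = "\<lambda>x. (q x - q0 x) * y0 x"])
    fix t assume t: "0 < t" "t < L"
    show "((\<lambda>x. y x - y0 x) has_real_derivative y' t - y0' t) (at t)"
      using y y0 t by (auto simp: ode_sol_def intro!: derivative_eq_intros)
    have "((\<lambda>x. y' x - y0' x) has_real_derivative q t * y t - q0 t * y0 t) (at t)"
      using y y0 t by (auto simp: ode_sol_def intro!: derivative_eq_intros)
    then show "((\<lambda>x. y' x - y0' x) has_real_derivative q t * (y t - y0 t) + (q t - q0 t) * y0 t) (at t)"
      by (simp add: algebra_simps)
    show "\<bar>q t\<bar> \<le> K + 1" using K(1)[of t] \<epsilon>(1)[of t] \<epsilon>(2) t by auto
    show "\<bar>(q t - q0 t) * y0 t\<bar> \<le> \<epsilon> * M"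
      unfolding abs_mult using \<epsilon>(1)[of t] M[of t] t by (intro mult_mono) auto
  qed (use y y0 K x in \<open>auto simp: ode_sol_def intro!: continuous_intros\<close>)
  then show ?thesis using data by (simp add: add.commute)
qed

text \<open>Uniqueness for the backward initial value problem: the perturbation estimate against the
  zero solution with the same potential has right-hand side 0.\<close>

lemma ode_sol_zero:
  assumes y: "ode_sol L q y y'" and data: "y L = 0" "y' L = 0"
    and q: "continuous_on {0..L} q" and x: "x \<in> {0..L}"
  shows "y x = 0"
proof -
  obtain K where K: "\<And>x. x \<in> {0..L} \<Longrightarrow> \<bar>q x\<bar> \<le> K" "0 \<le> K"
    using compact_imp_bounded[OF compact_continuous_image[OF q]]
    by (force simp: bounded_pos)
  have "ode_sol L q (\<lambda>_. 0) (\<lambda>_. 0)" by (auto simp: ode_sol_def)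
  from ode_sol_perturb[OF y this _ _ K, of 0 0 x] data x
  have "(y x)\<^sup>2 + (y' x)\<^sup>2 \<le> 0" by auto
  then show ?thesis
    by (simp add: sum_power2_le_zero_iff)
qed

text \<open>Green's identity: the Wronskian \<open>y' * z - y * z'\<close> has derivative
  \<open>(q - p) * y * z\<close>.\<close>

lemma wronskian_integral:
  assumes y: "ode_sol L q y y'" and z: "ode_sol L p z z'" and "0 \<le> L"
    and diff: "\<And>x. 0 < x \<Longrightarrow> x < L \<Longrightarrow> q x - p x = \<delta>"
  shows "(y' L * z L - y L * z' L) - (y' 0 * z 0 - y 0 * z' 0) = \<delta> * integral {0..L} (\<lambda>x. y x * z x)"
proof -
  have cont: "continuous_on {0..L} y" "continuous_on {0..L} y'" "continuous_on {0..L} z" "continuous_on {0..L} z'"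
    using y z by (auto simp: ode_sol_def)
  have "((\<lambda>x. \<delta> * (y x * z x)) has_integral
     (y' L * z L - y L * z' L) - (y' 0 * z 0 - y 0 * z' 0)) {0..L}"
  proof (rule fundamental_theorem_of_calculus_interior[OF \<open>0 \<le> L\<close>])
    show "continuous_on {0..L} (\<lambda>x. y' x * z x - y x * z' x)"
      by (intro continuous_intros cont)
    fix x assume "x \<in> {0<..<L}"
    then have x: "0 < x" "x < L" by auto
    have "((\<lambda>x. y' x * z x - y x * z' x) has_real_derivative (q x - p x) * (y x * z x)) (at x)"
      using y z x by (auto simp: ode_sol_def algebra_simps intro!: derivative_eq_intros)
    then show "((\<lambda>x. y' x * z x - y x * z' x) has_vector_derivative \<delta> * (y x * z x)) (at x)"
      using diff[OF x] by (simp add: has_real_derivative_iff_has_vector_derivative)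
  qed
  moreover have "((\<lambda>x. \<delta> * (y x * z x)) has_integral \<delta> * integral {0..L} (\<lambda>x. y x * z x)) {0..L}"
    by (intro has_integral_mult_right integrable_integral integrable_continuous_real continuous_intros cont)
  ultimately show ?thesis by (rule has_integral_unique)
qed

section \<open>The linearised equation\<close>

context stationary_wave
begin

lemma isCont_wave: "isCont \<Psi> x" "isCont \<Psi>' x"
  using deriv_wave deriv2_wave DERIV_isCont by blast+

text \<open>A conserved quantity of the profile equation; its constant is evaluated at
  \<open>L\<close>, where the slope vanishes.\<close>

lemma energy: "(\<Psi>' x)\<^sup>2 = \<omega> * (\<Psi> x)\<^sup>2 - (\<Psi> x)^4 / 2 + ((\<Psi> L)^4 / 2 - \<omega> * (\<Psi> L)\<^sup>2)"
proof -
  have "(\<Psi>' x)\<^sup>2 - \<omega> * (\<Psi> x)\<^sup>2 + (\<Psi> x)^4 / 2 = (\<Psi>' L)\<^sup>2 - \<omega> * (\<Psi> L)\<^sup>2 + (\<Psi> L)^4 / 2"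
    by (rule DERIV_isconst_all[of "\<lambda>x. (\<Psi>' x)\<^sup>2 - \<omega> * (\<Psi> x)\<^sup>2 + (\<Psi> x)^4 / 2"])
      (auto intro!: derivative_eq_intros deriv_wave deriv2_wave simp: algebra_simps power3_eq_cube)
  then show ?thesis by (simp add: deriv_L)
qed

lemma deriv_reflect: "\<Psi>' (2 * L - x) = - \<Psi>' x"
proof -
  have "((\<lambda>x. 2 * L - x) has_real_derivative - 1) (at x)"
    by (auto intro!: derivative_eq_intros)
  from DERIV_chain2[OF deriv_wave this] have "(\<Psi> has_real_derivative - \<Psi>' (2 * L - x)) (at x)" by (simp add: reflect)
  from DERIV_unique[OF this deriv_wave] show ?thesis by simp
qed

text \<open>Besides \<open>\<Psi>'\<close>, the linearised equation has a solution of the form \<open>a(\<Psi>) + \<Psi>' G\<close> with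
  \<open>G' = g(\<Psi>)\<close>. By the energy identity the equation becomes a polynomial one for \<open>a\<close> and \<open>g\<close>.\<close>

lemma linearised_second_solution:
  obtains v v' G where
    "\<And>x. (v has_real_derivative v' x) (at x)"
    "\<And>x. (v' has_real_derivative (\<omega> - 3 * (\<Psi> x)\<^sup>2) * v x) (at x)"
    "v L = \<Psi> L * (\<omega> - (\<Psi> L)\<^sup>2) * (2 * \<omega> - (\<Psi> L)\<^sup>2)" "v' L = 0"
    "\<And>x. v x = 2 * ((\<Psi> L)^4 / 2 - \<omega> * (\<Psi> L)\<^sup>2 + \<omega>\<^sup>2) * \<Psi> x - \<omega> * (\<Psi> x)^3 + \<Psi>' x * G x"
    "\<And>x. (G has_real_derivative 2 * ((\<Psi> L)^4 / 2 - \<omega> * (\<Psi> L)\<^sup>2) + \<omega> * (\<Psi> x)\<^sup>2) (at x)"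
    "G L = 0" "v' 0 = (2 * ((\<Psi> L)^4 - 2 * \<omega> * (\<Psi> L)\<^sup>2) + 2 * \<omega>\<^sup>2 - 2 * \<omega> * (\<Psi> 0)\<^sup>2) * \<Psi>' 0 + (\<omega> * \<Psi> 0 - (\<Psi> 0)^3) * G 0"
proof -
  \<comment> \<open>The constant in \<open>\<Psi>'\<^sup>2 = \<omega> * \<Psi>\<^sup>2 - \<Psi>^4 /
    2 + c\<close>.\<close>
  define c where "c = (\<Psi> L)^4 / 2 - \<omega> * (\<Psi> L)\<^sup>2"
  have "\<exists>F. \<forall>x::real. -\<infinity> < ereal x \<longrightarrow> ereal x < \<infinity> \<longrightarrow>
      (F has_vector_derivative 2 * c + \<omega> * (\<Psi> x)\<^sup>2) (at x)"
    by (rule einterval_antiderivative) (auto intro!: continuous_intros isCont_wave)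
  then obtain F where F: "\<And>x. (F has_real_derivative 2 * c + \<omega> * (\<Psi> x)\<^sup>2) (at x)"
    by (auto simp: has_real_derivative_iff_has_vector_derivative)
  \<comment> \<open>Normalised to vanish at \<open>L\<close>, which gives \<open>v' L = 0\<close>
    and so selects the solution that is even about \<open>L\<close>.\<close>
  define G where "G = (\<lambda>x. F x - F L)"
  have G: "(G has_real_derivative 2 * c + \<omega> * (\<Psi> x)\<^sup>2) (at x)" for x
    unfolding G_def by (auto intro!: derivative_eq_intros F)
  define v where "v = (\<lambda>x. 2 * (c + \<omega>\<^sup>2) * \<Psi> x - \<omega> * (\<Psi> x)^3 + \<Psi>' x * G x)"
  define v' where "v' = (\<lambda>x. (4 * c + 2 * \<omega>\<^sup>2 - 2 * \<omega> * (\<Psi> x)\<^sup>2) * \<Psi>' x + (\<omega> * \<Psi> x - (\<Psi> x)^3) * G x)"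
  show ?thesis
  proof
    show "(v has_real_derivative v' x) (at x)" for x
      unfolding v_def v'_def
      by (auto intro!: derivative_eq_intros deriv_wave deriv2_wave G simp: algebra_simps power2_eq_square power3_eq_cube)
    show "(v' has_real_derivative (\<omega> - 3 * (\<Psi> x)\<^sup>2) * v x) (at x)" for x
    proof -
      let ?p = "\<Psi> x" and ?p' = "\<Psi>' x" and ?g = "G x"
      have e: "?p' * ?p' = \<omega> * ?p\<^sup>2 - ?p^4 / 2 + c"
        using energy[of x] by (simp add: c_def power2_eq_square)
      have "(v' has_real_derivative
          (4 * c + 2 * \<omega>\<^sup>2 - 2 * \<omega> * ?p\<^sup>2) * (\<omega> * ?p - ?p^3) - 4 * \<omega> * ?p * (?p' * ?p') +
          (\<omega> * ?p' - 3 * ?p\<^sup>2 * ?p') * ?g + (\<omega> * ?p - ?p^3) * (2 * c + \<omega> * ?p\<^sup>2)) (at x)"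
        unfolding v'_def
        by (auto intro!: derivative_eq_intros deriv_wave deriv2_wave G simp: algebra_simps power2_eq_square)
      also have "(4 * c + 2 * \<omega>\<^sup>2 - 2 * \<omega> * ?p\<^sup>2) * (\<omega> * ?p - ?p^3) - 4 * \<omega> * ?p * (?p' * ?p') +
          (\<omega> * ?p' - 3 * ?p\<^sup>2 * ?p') * ?g + (\<omega> * ?p - ?p^3) * (2 * c + \<omega> * ?p\<^sup>2) = (\<omega> - 3 * ?p\<^sup>2) * v x"
        unfolding e v_def by (simp add: algebra_simps power2_eq_square power3_eq_cube power4_eq_xxxx)
      finally show ?thesis .
    qed
    show "v L = \<Psi> L * (\<omega> - (\<Psi> L)\<^sup>2) * (2 * \<omega> - (\<Psi> L)\<^sup>2)"
      by (simp add: v_def deriv_L c_def algebra_simps power2_eq_square power3_eq_cube power4_eq_xxxx)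
    show "v' L = 0" by (simp add: v'_def deriv_L G_def)
    show "v x = 2 * ((\<Psi> L)^4 / 2 - \<omega> * (\<Psi> L)\<^sup>2 + \<omega>\<^sup>2) * \<Psi> x - \<omega> * (\<Psi> x)^3 + \<Psi>' x * G x" for x
      by (simp add: v_def c_def)
    show "(G has_real_derivative 2 * ((\<Psi> L)^4 / 2 - \<omega> * (\<Psi> L)\<^sup>2) + \<omega> * (\<Psi> x)\<^sup>2) (at x)" for x
      using G[of x] by (simp add: c_def)
    show "G L = 0" by (simp add: G_def)
    show "v' 0 = (2 * ((\<Psi> L)^4 - 2 * \<omega> * (\<Psi> L)\<^sup>2) + 2 * \<omega>\<^sup>2 - 2 * \<omega> * (\<Psi> 0)\<^sup>2) * \<Psi>' 0 + (\<omega> * \<Psi> 0 - (\<Psi> 0)^3) * G 0"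
      by (simp add: v'_def c_def)
  qed
qed

text \<open>Differentiating the profile equation shows that \<open>\<Psi>'\<close> solves the
  linearised one.\<close>

lemma linearised_deriv:
  "(\<Psi>' has_real_derivative \<omega> * \<Psi> x - (\<Psi> x)^3) (at x)"
  "((\<lambda>x. \<omega> * \<Psi> x - (\<Psi> x)^3) has_real_derivative (\<omega> - 3 * (\<Psi> x)\<^sup>2) * \<Psi>' x) (at x)"
  by (auto intro!: derivative_eq_intros deriv_wave deriv2_wave simp: algebra_simps)

lemma ode_sol_wave_deriv:
  "ode_sol L (\<lambda>x. \<omega> - 3 * (\<Psi> x)\<^sup>2) \<Psi>' (\<lambda>x. \<omega> * \<Psi> x - (\<Psi> x)^3)"
  unfolding ode_sol_def using linearised_deriv
  by (auto intro!: continuous_intros continuous_at_imp_continuous_on isCont_wave)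

end

section \<open>The operator\<close>

lemma ac_deriv_integral:
  assumes "ac_deriv I f g" "a \<le> b" "{a..b} \<subseteq> I"
  shows "g integrable_on {a..b}" "f b = f a + integral {a..b} g"
  using assms set_lebesgue_integral_eq_integral[of "{a..b}" g]
  by (auto simp: ac_deriv_def algebra_simps)

lemma ac_deriv_continuous_on:
  assumes "ac_deriv I f g" "{a..b} \<subseteq> I"
  shows "continuous_on {a..b} f"
proof (cases "a \<le> b")
  case True
  have "f a + integral {a..x} g = f x" if "x \<in> {a..b}" for x
    using that assms(2) by (intro ac_deriv_integral(2)[OF assms(1), symmetric]) auto
  moreover have "continuous_on {a..b} (\<lambda>x. f a + integral {a..x} g)"
    by (intro continuous_intros indefinite_integral_continuous_1 ac_deriv_integral[OF assms(1) True assms(2)])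
  ultimately show ?thesis by (rule continuous_on_eq[rotated])
qed simp

lemma open_contains_interval:
  assumes "open I" "x \<in> I"
  obtains a b :: real where "a < x" "x < b" "{a..b} \<subseteq> I"
proof -
  obtain e where "0 < e" "cball x e \<subseteq> I" using assms by (meson open_contains_cball)
  then show ?thesis by (intro that[of "x - e" "x + e"]) (auto simp: cball_eq_atLeastAtMost)
qed

lemma ac_deriv_isCont:
  assumes "ac_deriv I f g" "open I" "x \<in> I"
  shows "isCont f x"
proof -
  obtain a b where "a < x" "x < b" "{a..b} \<subseteq> I" using open_contains_interval[OF assms(2,3)] .
  then show ?thesis
    using ac_deriv_continuous_on[OF assms(1), of a b] by (intro continuous_on_interior[of "{a..b}"]) auto
qed

text \<open>The integral does not see the null set where \<open>g\<close> differs from the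
  continuous \<open>h\<close>, and the fundamental theorem then applies at every point. This
  upgrades the almost-everywhere eigenvalue equation to a classical one.\<close>

lemma ac_deriv_has_vector_derivative:
  assumes ac: "ac_deriv I f g" and I: "open I" "x \<in> I"
    and ae: "AE x in lebesgue. x \<in> I \<longrightarrow> g x = h x" and h: "\<And>x. x \<in> I \<Longrightarrow> isCont h x"
  shows "(f has_vector_derivative h x) (at x)"
proof -
  obtain a b where ab: "a < x" "x < b" "{a..b} \<subseteq> I" using open_contains_interval[OF I] .
  have cont: "continuous_on {a..b} h"
    using h ab by (intro continuous_at_imp_continuous_on) auto
  have eq: "f t = f a + integral {a..t} h" if t: "t \<in> {a..b}" for t
  proof -
    have sub: "{a..t} \<subseteq> I" using t ab by auto
    have "set_integrable lebesgue {a..t} g" "f t - f a = (LINT x:{a..t}|lebesgue. g x)"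
      using ac t sub by (auto simp: ac_deriv_def)
    moreover have h_int: "set_integrable lebesgue {a..t} h"
      by (intro absolutely_integrable_continuous_real continuous_on_subset[OF cont]) (use t in auto)
    moreover have "(LINT x:{a..t}|lebesgue. g x) = (LINT x:{a..t}|lebesgue. h x)"
      unfolding set_lebesgue_integral_def
    proof (rule integral_cong_AE)
      show "AE x in lebesgue. indicator {a..t} x *\<^sub>R g x = indicator {a..t} x *\<^sub>R h x"
        using ae by eventually_elim (use sub in \<open>auto simp: indicator_def\<close>)
    qed (use calculation(1) h_int in \<open>auto simp: set_integrable_def\<close>)
    ultimately show ?thesis
      using set_lebesgue_integral_eq_integral(2)[OF h_int] by (simp add: algebra_simps)
  qed
  have "((\<lambda>t. integral {a..t} h) has_vector_derivative h x) (at x within {a..b})"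
    using ab by (intro integral_has_vector_derivative cont) auto
  then have "((\<lambda>t. f a + integral {a..t} h) has_vector_derivative h x) (at x within {a..b})"
    using has_vector_derivative_add[OF has_vector_derivative_const] by fastforce
  then have "(f has_vector_derivative h x) (at x within {a..b})"
    by (rule has_vector_derivative_transform[rotated 2]) (use ab eq[symmetric] in auto)
  then show ?thesis using ab by (simp add: at_within_Icc_at)
qed

lemma ac_deriv_continuous_has_vector_derivative:
  assumes "ac_deriv I f g" "ac_deriv I g h" "open I" "x \<in> I"
  shows "(f has_vector_derivative g x) (at x)"
  by (rule ac_deriv_has_vector_derivative[OF assms(1,3,4)]) (auto intro: ac_deriv_isCont assms)

lemma ac_derivI:
  assumes "\<And>x. (f has_vector_derivative g x) (at x)" "continuous_on UNIV g"
  shows "ac_deriv I f g"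
  unfolding ac_deriv_def
proof safe
  fix a b :: real assume "a \<le> b"
  have int: "set_integrable lebesgue {a..b} g"
    by (intro absolutely_integrable_continuous_real continuous_on_subset[OF assms(2)]) auto
  then show "set_integrable lebesgue {a..b} g" .
  have "(g has_integral f b - f a) {a..b}"
    using \<open>a \<le> b\<close> assms(1) by (intro fundamental_theorem_of_calculus) (auto intro: has_vector_derivative_at_within)
  then show "f b - f a = (LINT x:{a..b}|lebesgue. g x)"
    using set_lebesgue_integral_eq_integral(2)[OF int] by (simp add: integral_unique)
qed

lemma L2_on_continuous:
  assumes f: "continuous_on UNIV f" and S: "S \<in> sets lebesgue" "bounded S"
  shows "L2_on S f"
proof -
  have "f \<in> borel_measurable lebesgue"
    using borel_measurable_continuous_onI[OF f] by (intro measurable_completion) simp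
  then have "set_borel_measurable lebesgue S f"
    using S unfolding set_borel_measurable_def by measurable
  moreover obtain a where a: "S \<subseteq> {-a..a}" using S(2) bounded_subset_cbox_symmetric[of S] by auto
  have "set_integrable lebesgue {-a..a} (\<lambda>x. (norm (f x))\<^sup>2)"
    by (intro absolutely_integrable_continuous_real continuous_intros continuous_on_subset[OF f]) auto
  then have "set_integrable lebesgue S (\<lambda>x. (norm (f x))\<^sup>2)"
    by (rule set_integrable_subset) (use S a in auto)
  ultimately show ?thesis by (simp add: L2_on_def)
qed

lemma periodic_int: "periodic L f \<Longrightarrow> f (x + 2 * L * of_int n) = f x"
proof (induction n rule: int_induct[where k = 0])
  case (step1 i)
  have "f (x + 2 * L * of_int (i + 1)) = f ((x + 2 * L * of_int i) + 2 * L)"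
    by (simp add: algebra_simps)
  then show ?case using step1 by (simp add: periodic_def)
next
  case (step2 i)
  have "f (x + 2 * L * of_int i) = f ((x + 2 * L * of_int (i - 1)) + 2 * L)"
    by (simp add: algebra_simps)
  then show ?case using step2 by (simp add: periodic_def)
qed simp

lemma periodic_eq_zeroI:
  assumes "periodic L f" "0 < L" and zero: "\<And>x. 0 \<le> x \<Longrightarrow> x \<le> 2 * L \<Longrightarrow> f x = 0"
  shows "f = 0"
proof
  fix x
  let ?n = "\<lfloor>x / (2 * L)\<rfloor>"
  have "0 \<le> x - 2 * L * of_int ?n" "x - 2 * L * of_int ?n \<le> 2 * L"
    using floor_divide_lower[of "2 * L" x] floor_divide_upper[of "2 * L" x] \<open>0 < L\<close>
    by (simp_all add: distrib_left mult.commute)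
  from zero[OF this] show "f x = 0 x"
    using periodic_int[OF assms(1), of x "- ?n"] by simp
qed

text \<open>For \<open>Z = 0\<close> there is no jump, so smooth periodic solutions lie in the
  domain. This places explicit functions in the kernel.\<close>

lemma eigenspaceI_smooth:
  fixes u u' u'' :: "real \<Rightarrow> real"
  assumes u: "\<And>x. (u has_real_derivative u' x) (at x)"
    and u': "\<And>x. (u' has_real_derivative u'' x) (at x)"
    and u'': "continuous_on UNIV u''"
    and per: "\<And>x. u (x + 2 * L) = u x"
    and eq: "\<And>x. u'' x = (\<omega> - 3 * (\<phi> x)\<^sup>2 - \<nu>) * u x"
  shows "(\<lambda>x. complex_of_real (u x)) \<in> eigenspace (L1_graph L \<omega> 0 \<phi>) \<nu>"
proof -
  let ?u = "\<lambda>x. complex_of_real (u x)" and ?u' = "\<lambda>x. complex_of_real (u' x)"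
    and ?u'' = "\<lambda>x. complex_of_real (u'' x)"
  have cont_u: "continuous_on UNIV u" "continuous_on UNIV u'"
    using u u' by (auto intro!: continuous_at_imp_continuous_on DERIV_isCont)
  have cont: "continuous_on UNIV ?u" "continuous_on UNIV ?u'" "continuous_on UNIV ?u''"
    by (intro continuous_intros cont_u u'')+
  have deriv: "(?u has_vector_derivative ?u' x) (at x)" "(?u' has_vector_derivative ?u'' x) (at x)" for x
    using u u' by (auto intro: has_vector_derivative_of_real)
  have D1: "D1 ?u = ?u'"
    using deriv(1) by (auto simp: D1_def fun_eq_iff intro: vector_derivative_at)
  have ac: "ac_deriv I ?u ?u'" "ac_deriv I ?u' ?u''" for I
    by (intro ac_derivI deriv cont)+
  have L2: "L2_on S ?u" "L2_on S ?u'" "L2_on S ?u''" if "S \<in> sets lebesgue" "bounded S" for S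
    using that by (intro L2_on_continuous cont; simp)+
  have "periodic L ?u" using per by (simp add: periodic_def)
  then have H1: "?u \<in> H1_per L"
    using L2 ac by (auto simp: H1_per_def L2_per_def intro!: exI[of _ ?u'])
  have H2: "?u \<in> H2_on S" if "S \<in> sets lebesgue" "bounded S" for S
    using L2[OF that] ac by (auto simp: H2_on_def)
  have H2a: "?u \<in> H2_on ({-L<..<L} - {0})"
  proof (rule H2)
    show "bounded ({-L<..<L} - {0})" by (rule bounded_subset[of "{-L<..<L}"]) auto
  qed simp
  have H2b: "?u \<in> H2_on {0<..<2 * L}"
    by (rule H2) auto
  have "(?u' \<longlongrightarrow> ?u' 0) (at 0)"
    by (intro tendsto_of_real isContD DERIV_isCont[OF u'])
  then have "(?u' \<longlongrightarrow> ?u' 0) (at_right 0)" "(?u' \<longlongrightarrow> ?u' 0) (at_left 0)"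
    by (auto simp: filterlim_at_split)
  then have "\<exists>p m. (D1 ?u \<longlongrightarrow> p) (at_right 0) \<and> (D1 ?u \<longlongrightarrow> m) (at_left 0) \<and> p - m = - of_real 0 * ?u 0"
    unfolding D1 by (intro exI[of _ "?u' 0"]) simp
  then have "?u \<in> L1_domain L 0"
    using H1 H2a H2b unfolding L1_domain_def by blast
  moreover have "(\<lambda>x. of_real \<nu> * ?u x) \<in> L2_per L"
    using per by (auto simp: L2_per_def periodic_def intro!: L2_on_continuous continuous_intros cont_u)
  moreover have "AE x in lebesgue. of_real \<nu> * ?u x =
      - ?u'' x + of_real \<omega> * ?u x - 3 * of_real ((\<phi> x)\<^sup>2) * ?u x"
    by (intro AE_I2) (simp add: eq algebra_simps)
  ultimately show ?thesis
    using ac(2) by (simp only: eigenspace_def L1_graph_def mem_Collect_eq case_prod_conv D1) blast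
qed

section \<open>Simple eigenvalues, and eigenfunctions as solutions on the half interval\<close>

interpretation cfun: vector_space "\<lambda>(c::complex) f (x::real). c * f x"
  by unfold_locales (auto simp: fun_eq_iff algebra_simps)

text \<open>A basis with \<open>card\<close> equal to 1 cannot be infinite, so the eigenspace lies
  in the span of a single function.\<close>

lemma eig_multiplicity_1_dependent:
  assumes "eig_multiplicity A \<mu> = 1" "u \<in> eigenspace A \<mu>" "v \<in> eigenspace A \<mu>" "u \<noteq> 0"
  obtains c where "v = (\<lambda>x. c * u x)"
proof -
  obtain B where B: "eigenspace A \<mu> \<subseteq> cfun.span B" "card B = cfun.dim (eigenspace A \<mu>)"
    by (rule cfun.basis_exists)
  with assms(1) have "card B = 1" by (simp add: eig_multiplicity_def)
  then obtain b where "B = {b}" by (auto simp: card_1_singleton_iff)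
  then have "u \<in> cfun.span {b}" "v \<in> cfun.span {b}"
    using B assms by auto
  then obtain c d where "u = (\<lambda>x. c * b x)" "v = (\<lambda>x. d * b x)"
    by (auto simp: cfun.span_singleton)
  then show ?thesis using \<open>u \<noteq> 0\<close> by (intro that[of "d / c"]) (auto simp: fun_eq_iff)
qed


text \<open>Translates membership in the graph into a classical equation on \<open>(0, 2L)\<close>.
  The jump at 0 becomes a relation between the two ends of this interval, as periodicity moves the
  left limit at 0 to \<open>2 * L\<close>.\<close>

lemma eigenfunction_ode:
  assumes wave: "stationary_wave L \<omega> Z \<phi> \<Psi> \<Psi>'" and "0 < L"
    and \<zeta>: "\<zeta> \<in> eigenspace (L1_graph L \<omega> Z \<phi>) \<nu>"
  obtains \<zeta>' p m where
    "\<And>x. isCont \<zeta> x" "periodic L \<zeta>"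
    "\<And>x. 0 < x \<Longrightarrow> x < 2 * L \<Longrightarrow> (\<zeta> has_vector_derivative \<zeta>' x) (at x)"
    "\<And>x. 0 < x \<Longrightarrow> x < 2 * L \<Longrightarrow>
       (\<zeta>' has_vector_derivative of_real (\<omega> - 3 * (\<Psi> x)\<^sup>2 - \<nu>) * \<zeta> x) (at x)"
    "(\<zeta>' \<longlongrightarrow> p) (at_right 0)" "((\<lambda>x. \<zeta>' (2 * L - x)) \<longlongrightarrow> m) (at_right 0)"
    "p - m = - of_real Z * \<zeta> 0"
proof -
  interpret stationary_wave L \<omega> Z \<phi> \<Psi> \<Psi>' by (rule wave)
  let ?I = "{0<..<2 * L}"
  from \<zeta> obtain h where dom: "\<zeta> \<in> L1_domain L Z"
    and h: "ac_deriv (- range (\<lambda>n::int. 2 * L * of_int n)) (D1 \<zeta>) h"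
    and ae: "AE x in lebesgue. of_real \<nu> * \<zeta> x =
        - h x + of_real \<omega> * \<zeta> x - 3 * of_real ((\<phi> x)\<^sup>2) * \<zeta> x"
    by (auto simp: eigenspace_def L1_graph_def)
  from dom obtain p m where pm: "(D1 \<zeta> \<longlongrightarrow> p) (at_right 0)" "(D1 \<zeta> \<longlongrightarrow> m) (at_left 0)"
      "p - m = - of_real Z * \<zeta> 0" and H: "\<zeta> \<in> H1_per L" "\<zeta> \<in> H2_on ?I"
    by (auto simp: L1_domain_def)
  from H(1) obtain g where per: "periodic L \<zeta>" and "ac_deriv UNIV \<zeta> g"
    by (auto simp: H1_per_def L2_per_def)
  then have cont: "isCont \<zeta> x" for x by (auto intro: ac_deriv_isCont)
  from H(2) obtain g1 h1 where g1: "ac_deriv ?I \<zeta> g1" "ac_deriv ?I g1 h1"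
    by (auto simp: H2_on_def)
  have deriv: "(\<zeta> has_vector_derivative D1 \<zeta> x) (at x)" if "x \<in> ?I" for x
    using ac_deriv_continuous_has_vector_derivative[OF g1 _ that]
    by (simp add: D1_def vector_derivative_at)
  have "?I \<subseteq> - range (\<lambda>n::int. 2 * L * of_int n)"
  proof safe
    fix n :: int assume "2 * L * of_int n \<in> ?I"
    then have "0 < n" "n < 1"
      using \<open>0 < L\<close> by (auto simp: zero_less_mult_iff)
    then show False by linarith
  qed
  with h have h: "ac_deriv ?I (D1 \<zeta>) h" unfolding ac_deriv_def by blast
  have ae': "AE x in lebesgue. x \<in> ?I \<longrightarrow> h x = of_real (\<omega> - 3 * (\<Psi> x)\<^sup>2 - \<nu>) * \<zeta> x"
    using ae
  proof eventually_elim
    case (elim x)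
    then show ?case using profile_eq[of x] by (auto simp: algebra_simps)
  qed
  have deriv2: "(D1 \<zeta> has_vector_derivative of_real (\<omega> - 3 * (\<Psi> x)\<^sup>2 - \<nu>) * \<zeta> x) (at x)"
    if "x \<in> ?I" for x
    by (rule ac_deriv_has_vector_derivative[OF h _ that ae'])
      (auto intro!: continuous_intros isCont_wave cont)
  \<comment> \<open>Periodicity passes from \<open>\<zeta>\<close> to its derivative; this
    identifies the limit at \<open>0\<close> from the left with the one at
    \<open>2 * L\<close>.\<close>
  have shift: "D1 \<zeta> (x - 2 * L) = D1 \<zeta> x" if "x \<in> ?I" for x
  proof -
    have "((\<lambda>x. x + 2 * L) has_vector_derivative 1) (at (x - 2 * L))"
      by (auto intro!: derivative_eq_intros)
    from vector_diff_chain_at[OF this, of \<zeta> "D1 \<zeta> x"] deriv[OF that]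
    have "((\<lambda>x. \<zeta> (x + 2 * L)) has_vector_derivative D1 \<zeta> x) (at (x - 2 * L))"
      by (simp add: o_def)
    then have "(\<zeta> has_vector_derivative D1 \<zeta> x) (at (x - 2 * L))"
      using per by (simp add: periodic_def)
    from vector_derivative_at[OF this] show ?thesis by (simp only: D1_def)
  qed
  have "((\<lambda>x. D1 \<zeta> (- x)) \<longlongrightarrow> m) (at_right 0)"
    using pm(2) by (simp add: at_left_minus[of "0::real"] filterlim_filtermap)
  moreover have "eventually (\<lambda>x. D1 \<zeta> (- x) = D1 \<zeta> (2 * L - x)) (at_right 0)"
    unfolding eventually_at_right_field
  proof (intro exI[of _ "2 * L"] conjI allI impI)
    fix x :: real assume "0 < x" "x < 2 * L"
    then show "D1 \<zeta> (- x) = D1 \<zeta> (2 * L - x)" using shift[of "2 * L - x"] by simp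
  qed (use \<open>0 < L\<close> in simp)
  ultimately have "((\<lambda>x. D1 \<zeta> (2 * L - x)) \<longlongrightarrow> m) (at_right 0)"
    by (rule Lim_transform_eventually)
  with pm show ?thesis
    using deriv deriv2 by (intro that[of "D1 \<zeta>" p m] cont per) auto
qed

text \<open>The two alternatives are the parts of an eigenfunction even and odd about
  \<open>L\<close>. The jump at 0 becomes a Robin condition for the even part, and
  \<open>\<zeta> (2 * L) = \<zeta> 0\<close> a Dirichlet condition for the odd part. By uniqueness
  the value and the slope at \<open>L\<close> do not both vanish, so one part can be
  normalised.\<close>

lemma eigenvalue_shooting:
  assumes wave: "stationary_wave L \<omega> Z \<phi> \<Psi> \<Psi>'" and "0 < L"
    and ev: "eigenvalue (L1_graph L \<omega> Z \<phi>) \<nu>"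
  defines "q \<equiv> \<lambda>x. \<omega> - 3 * (\<Psi> x)\<^sup>2 - \<nu>"
  shows "(\<exists>v v'. ode_sol L q v v' \<and> v L = 1 \<and> v' L = 0 \<and> v' 0 + Z / 2 * v 0 = 0) \<or>
    (\<exists>w w'. ode_sol L q w w' \<and> w L = 0 \<and> w' L = 1 \<and> w 0 = 0)"
proof -
  interpret stationary_wave L \<omega> Z \<phi> \<Psi> \<Psi>' by (rule wave)
  from ev obtain \<zeta> where \<zeta>: "\<zeta> \<in> eigenspace (L1_graph L \<omega> Z \<phi>) \<nu>" "\<zeta> \<noteq> 0"
    by (auto simp: eigenvalue_def)
  obtain \<zeta>' p m where cont: "\<And>x. isCont \<zeta> x" and per: "periodic L \<zeta>"
    and deriv: "\<And>x. 0 < x \<Longrightarrow> x < 2 * L \<Longrightarrow> (\<zeta> has_vector_derivative \<zeta>' x) (at x)"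
    and deriv2: "\<And>x. 0 < x \<Longrightarrow> x < 2 * L \<Longrightarrow> (\<zeta>' has_vector_derivative of_real (q x) * \<zeta> x) (at x)"
    and lim: "(\<zeta>' \<longlongrightarrow> p) (at_right 0)" "((\<lambda>x. \<zeta>' (2 * L - x)) \<longlongrightarrow> m) (at_right 0)"
    and jump: "p - m = - of_real Z * \<zeta> 0"
    unfolding q_def using eigenfunction_ode[OF wave \<open>0 < L\<close> \<zeta>(1)] by metis
  \<comment> \<open>\<open>\<sigma> = 1\<close> gives the even part and \<open>\<sigma> = -1\<close>
    the odd one. The complex factor \<open>c\<close> normalises at \<open>L\<close> before the real
    part is taken.\<close>
  define y where "y = (\<lambda>\<sigma> c x. Re (c * (\<zeta> x + \<sigma> * \<zeta> (2 * L - x))))"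
  \<comment> \<open>At the defect the one-sided limits \<open>p\<close> and \<open>m\<close> stand
    in for the derivative.\<close>
  define y' where "y' = (\<lambda>\<sigma> c x. Re (c * (if x = 0 then p - \<sigma> * m else \<zeta>' x - \<sigma> * \<zeta>' (2 * L - x))))"
  have reflected: "((\<lambda>x. f (2 * L - x)) has_vector_derivative - D) (at x)"
    if "(f has_vector_derivative D) (at (2 * L - x))" for f :: "real \<Rightarrow> complex" and D x
  proof -
    have "((\<lambda>x. 2 * L - x) has_vector_derivative - 1) (at x)"
      by (auto intro!: derivative_eq_intros)
    from vector_diff_chain_at[OF this that] show ?thesis by (simp add: o_def)
  qed
  have q_reflect: "q (2 * L - x) = q x" for x by (simp add: q_def reflect)
  have sol: "ode_sol L q (y \<sigma> c) (y' \<sigma> c)" for \<sigma> c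
  proof -
    have "(y \<sigma> c has_real_derivative y' \<sigma> c x) (at x)" if x: "0 < x" "x < L" for x
    proof -
      have "((\<lambda>x. c * (\<zeta> x + \<sigma> * \<zeta> (2 * L - x))) has_vector_derivative
          c * (\<zeta>' x + \<sigma> * - \<zeta>' (2 * L - x))) (at x)"
        using x by (intro has_vector_derivative_mult_right has_vector_derivative_add reflected deriv) auto
      from bounded_linear.has_vector_derivative[OF bounded_linear_Re this] show ?thesis
        using x by (simp add: y_def y'_def has_real_derivative_iff_has_vector_derivative)
    qed
    moreover have deriv2': "(y' \<sigma> c has_real_derivative q x * y \<sigma> c x) (at x)" if x: "0 < x" "x < 2 * L" for x
    proof -
      have "((\<lambda>x. c * (\<zeta>' x - \<sigma> * \<zeta>' (2 * L - x))) has_vector_derivative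
          c * (of_real (q x) * \<zeta> x - \<sigma> * - (of_real (q (2 * L - x)) * \<zeta> (2 * L - x)))) (at x)"
        using x by (intro has_vector_derivative_mult_right has_vector_derivative_diff reflected deriv2) auto
      note bounded_linear.has_vector_derivative[OF bounded_linear_Re this]
      also have "Re (c * (of_real (q x) * \<zeta> x - \<sigma> * - (of_real (q (2 * L - x)) * \<zeta> (2 * L - x)))) = q x * y \<sigma> c x"
        unfolding y_def q_reflect by (simp add: algebra_simps)
      finally have "(y' \<sigma> c has_vector_derivative q x * y \<sigma> c x) (at x)"
        by (rule has_vector_derivative_transform_within_open[of _ _ _ "{0<..}"])
          (use x in \<open>auto simp: y'_def\<close>)
      then show ?thesis by (simp add: has_real_derivative_iff_has_vector_derivative)
    qed
    moreover have "continuous_on {0..L} (y \<sigma> c)"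
      unfolding y_def
      by (intro continuous_intros continuous_at_imp_continuous_on ballI cont isCont_o2[OF _ cont])
    moreover have "continuous_on {0..L} (y' \<sigma> c)"
    proof (rule continuous_on_IccI[OF _ _ _ \<open>0 < L\<close>])
      have "((\<lambda>x. Re (c * (\<zeta>' x - \<sigma> * \<zeta>' (2 * L - x)))) \<longlongrightarrow> y' \<sigma> c 0) (at_right 0)"
        unfolding y'_def by (auto intro!: tendsto_intros lim)
      then show "(y' \<sigma> c \<longlongrightarrow> y' \<sigma> c 0) (at_right 0)"
        by (rule Lim_transform_eventually)
          (auto simp: eventually_at_right_field y'_def intro!: exI[of _ 1])
      have lim_y': "y' \<sigma> c \<midarrow>x\<rightarrow> y' \<sigma> c x" if "0 < x" "x < 2 * L" for x
        using deriv2'[OF that] by (intro isContD DERIV_isCont)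
      then show "y' \<sigma> c \<midarrow>x\<rightarrow> y' \<sigma> c x" if "0 < x" "x < L" for x
        using that by simp
      show "(y' \<sigma> c \<longlongrightarrow> y' \<sigma> c L) (at_left L)"
        using lim_y'[of L] \<open>0 < L\<close> by (simp add: filterlim_at_split)
    qed
    ultimately show ?thesis unfolding ode_sol_def by auto
  qed
  have q: "continuous_on {0..L} q"
    unfolding q_def by (intro continuous_intros continuous_at_imp_continuous_on ballI isCont_wave)
  have \<zeta>_2L: "\<zeta> (2 * L) = \<zeta> 0" using per unfolding periodic_def by (metis add_0)
  consider "\<zeta> L \<noteq> 0" | "\<zeta>' L \<noteq> 0" | "\<zeta> L = 0" "\<zeta>' L = 0" by blast
  then show ?thesis
  proof cases
    case 1
    \<comment> \<open>The even part takes the value \<open>2 * \<zeta> L\<close> at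
      \<open>L\<close>.\<close>
    define c where "c = 1 / (2 * \<zeta> L)"
    have "y' 1 c 0 = Re (c * (p - m))" by (simp add: y'_def)
    also have "c * (p - m) = of_real (- Z / 2) * (c * (\<zeta> 0 + 1 * \<zeta> (2 * L - 0)))"
      by (simp add: jump \<zeta>_2L)
    also have "Re \<dots> = - Z / 2 * y 1 c 0"
      unfolding y_def by (simp only: Re_complex_of_real times_complex.sel Im_complex_of_real)
    finally have "y' 1 c 0 + Z / 2 * y 1 c 0 = 0" by simp
    moreover have "c * (\<zeta> L + 1 * \<zeta> (2 * L - L)) = 1" using 1 by (simp add: c_def)
    then have "y 1 c L = 1" by (simp only: y_def one_complex.sel)
    moreover have "y' 1 c L = 0" using \<open>0 < L\<close> by (simp add: y'_def)
    ultimately show ?thesis using sol by blast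
  next
    case 2
    define c where "c = 1 / (2 * \<zeta>' L)"
    have "c * (if L = 0 then p - (-1) * m else \<zeta>' L - (-1) * \<zeta>' (2 * L - L)) = 1"
      using 2 \<open>0 < L\<close> by (simp add: c_def)
    then have "y' (-1) c L = 1" by (simp only: y'_def one_complex.sel)
    moreover have "y (-1) c L = 0" "y (-1) c 0 = 0"
      by (auto simp: y_def \<zeta>_2L)
    ultimately show ?thesis using sol by blast
  next
    case 3
    have zero: "y \<sigma> c x = 0" if "x \<in> {0..L}" for \<sigma> c x
      using 3 \<open>0 < L\<close> by (intro ode_sol_zero[OF sol _ _ q that]) (auto simp: y_def y'_def)
    \<comment> \<open>\<open>c = 1\<close> yields the real part and \<open>c = - \<i>\<close> the
      imaginary part.\<close>
    have sum: "\<zeta> x + \<sigma> * \<zeta> (2 * L - x) = 0" if "x \<in> {0..L}" for \<sigma> x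
      using zero[OF that, of \<sigma> 1] zero[OF that, of \<sigma> "- \<i>"] by (auto simp: y_def complex_eq_iff)
    have "\<zeta> x = 0" "\<zeta> (2 * L - x) = 0" if "x \<in> {0..L}" for x
      using sum[OF that, of 0] sum[OF that, of 1] by auto
    then have "\<zeta> x = 0" if "0 \<le> x" "x \<le> 2 * L" for x
    proof (cases "x \<le> L")
      case False
      then show ?thesis using \<open>\<And>x. x \<in> {0..L} \<Longrightarrow> \<zeta> (2 * L - x) = 0\<close>[of "2 * L - x"] that by simp
    qed (use that in auto)
    then have "\<zeta> = 0" using per \<open>0 < L\<close> by (intro periodic_eq_zeroI)
    with \<zeta>(2) show ?thesis by simp
  qed
qed

section \<open>Eigenvalues near zero\<close>

lemma abs_le_of_sum_squares_le:
  fixes a b c :: real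
  assumes "a\<^sup>2 + b\<^sup>2 \<le> c\<^sup>2" "0 \<le> c" shows "\<bar>a\<bar> \<le> c" "\<bar>b\<bar> \<le> c"
proof -
  have "a\<^sup>2 \<le> c\<^sup>2" "b\<^sup>2 \<le> c\<^sup>2" using assms(1) zero_le_power2[of a] zero_le_power2[of b] by linarith+
  then show "\<bar>a\<bar> \<le> c" "\<bar>b\<bar> \<le> c" using assms(2) by (simp_all add: abs_le_square_iff[symmetric])
qed

lemma cancel_half: "d \<noteq> 0 \<Longrightarrow> d * (i / (2 * d)) = i / 2" for d i :: real
  by simp

lemma continuous_on_interval_bounded:
  fixes f :: "real \<Rightarrow> real"
  assumes "continuous_on {a..b} f"
  shows "\<exists>M\<ge>0. \<forall>x\<in>{a..b}. \<bar>f x\<bar> \<le> M"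
proof -
  have "bounded (f ` {a..b})"
    by (intro compact_imp_bounded compact_continuous_image assms) simp
  then show ?thesis unfolding bounded_pos by (auto intro: less_imp_le)
qed

text \<open>Split \<open>f * g - f0 * g0\<close> as \<open>(f - f0) * g + f0 * (g - g0)\<close>,
  where \<open>\<bar>g\<bar> \<le> M + 1\<close>. The lower bound carries the positivity of a
  limiting integral over to nearby functions.\<close>

lemma integral_product_close:
  fixes f g f0 g0 :: "real \<Rightarrow> real"
  assumes cont: "continuous_on {0..L} f" "continuous_on {0..L} g"
      "continuous_on {0..L} f0" "continuous_on {0..L} g0"
    and close: "\<And>x. x \<in> {0..L} \<Longrightarrow> \<bar>f x - f0 x\<bar> \<le> \<epsilon>" "\<And>x. x \<in> {0..L} \<Longrightarrow> \<bar>g x - g0 x\<bar> \<le> \<epsilon>"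
    and bound: "\<And>x. x \<in> {0..L} \<Longrightarrow> \<bar>f0 x\<bar> \<le> M" "\<And>x. x \<in> {0..L} \<Longrightarrow> \<bar>g0 x\<bar> \<le> M"
    and "\<epsilon> \<le> 1" "0 \<le> L"
  shows "integral {0..L} (\<lambda>x. f0 x * g0 x) - (2 * M + 1) * \<epsilon> * L \<le> integral {0..L} (\<lambda>x. f x * g x)"
proof -
  have "integral {0..L} (\<lambda>x. f0 x * g0 x - (2 * M + 1) * \<epsilon>) \<le> integral {0..L} (\<lambda>x. f x * g x)"
  proof (rule integral_le)
    fix x assume x: "x \<in> {0..L}"
    have "\<bar>g x\<bar> \<le> M + 1" using close(2)[OF x] bound(2)[OF x] \<open>\<epsilon> \<le> 1\<close> by linarith
    then have "\<bar>f x - f0 x\<bar> * \<bar>g x\<bar> \<le> \<epsilon> * (M + 1)"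
      using close(1)[OF x] by (intro mult_mono) auto
    moreover have "\<bar>f0 x\<bar> * \<bar>g x - g0 x\<bar> \<le> M * \<epsilon>"
      using close(2)[OF x] bound(1)[OF x] by (intro mult_mono) auto
    moreover have "f x * g x - f0 x * g0 x = (f x - f0 x) * g x + f0 x * (g x - g0 x)"
      by (simp add: algebra_simps)
    ultimately show "f0 x * g0 x - (2 * M + 1) * \<epsilon> \<le> f x * g x"
      unfolding abs_mult[symmetric] by (simp add: algebra_simps)
  qed (intro integrable_continuous_real continuous_intros cont)+
  moreover have "integral {0..L} (\<lambda>x. f0 x * g0 x - (2 * M + 1) * \<epsilon>) =
      integral {0..L} (\<lambda>x. f0 x * g0 x) - (2 * M + 1) * \<epsilon> * L"
    using \<open>0 \<le> L\<close>
    by (subst Henstock_Kurzweil_Integration.integral_diff)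
      (auto intro!: integrable_continuous_real continuous_intros cont)
  ultimately show ?thesis by simp
qed

text \<open>Continuity in \<open>Z\<close> enters through the value at \<open>L\<close> alone, which
  is \<open>\<eta>\<^sub>2 Z\<close> for the given profiles. \<open>min_0\<close> and
  \<open>max_0\<close> place the wave at \<open>Z = 0\<close> on either side of the equilibrium
  \<open>sqrt \<omega>\<close>, which fixes the sign of its second derivative at \<open>L\<close>
  and at 0.\<close>

locale wave_family =
  fixes L \<omega> Z0 :: real and \<phi> \<Psi> \<Psi>' :: "real \<Rightarrow> real \<Rightarrow> real"
  assumes L: "0 < L" and \<omega>: "0 < \<omega>" and Z0: "0 < Z0"
    and wave: "\<And>Z. Z \<in> {-Z0<..<Z0} \<Longrightarrow> stationary_wave L \<omega> Z (\<phi> Z) (\<Psi> Z) (\<Psi>' Z)"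
    and lim: "((\<lambda>Z. \<Psi> Z L) \<longlongrightarrow> \<Psi> 0 L) (at 0)"
    and even_0: "\<And>x. \<Psi> 0 (- x) = \<Psi> 0 x" and profile_0: "\<phi> 0 = \<Psi> 0"
    and min_0: "(\<Psi> 0 L)\<^sup>2 < \<omega>" and max_0: "\<omega> < (\<Psi> 0 0)\<^sup>2"
begin

sublocale w0: stationary_wave L \<omega> 0 "\<phi> 0" "\<Psi> 0" "\<Psi>' 0"
  using wave Z0 by simp

section \<open>Continuous dependence on \<open>(Z, \<nu>)\<close> at the origin\<close>

abbreviation near :: "(real \<times> real) filter" where
  "near \<equiv> nhds 0 \<times>\<^sub>F nhds 0"

definition q :: "real \<Rightarrow> real \<Rightarrow> real \<Rightarrow> real" where
  "q Z \<nu> x = \<omega> - 3 * (\<Psi> Z x)\<^sup>2 - \<nu>"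

text \<open>A common Gronwall factor: \<open>7 * \<omega>\<close> bounds the potentials met below
  because \<open>\<Psi>\<^sup>2 \<le> 2 * \<omega>\<close>, and \<open>3\<close> comes from
  \<open>ode_sol_perturb\<close>. Square roots of the factor are avoided through
  \<open>C \<le> C * C\<close>.\<close>

definition C :: real where "C = exp ((7 * \<omega> + 3) * L)"

lemma C_ge_1: "1 \<le> C" using L \<omega> by (simp add: C_def)

lemma Psi_le: "Z \<in> {-Z0<..<Z0} \<Longrightarrow> \<bar>\<Psi> Z x\<bar> \<le> sqrt (2 * \<omega>)"
  using stationary_wave.sq_le[OF wave] stationary_wave.pos[OF wave] by (simp add: real_le_rsqrt less_imp_le)

text \<open>Factoring the difference of cubes, the difference of two waves solves a linear equation
  with bounded potential. Its slope at \<open>L\<close> is 0, so the difference of the values at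
  \<open>L\<close> controls it.\<close>

lemma Psi_close:
  assumes Z: "Z \<in> {-Z0<..<Z0}" and x: "x \<in> {0..L}"
  shows "\<bar>\<Psi> Z x - \<Psi> 0 x\<bar> \<le> C * \<bar>\<Psi> Z L - \<Psi> 0 L\<bar>" "\<bar>\<Psi>' Z x - \<Psi>' 0 x\<bar> \<le> C * \<bar>\<Psi> Z L - \<Psi> 0 L\<bar>"
proof -
  interpret stationary_wave L \<omega> Z "\<phi> Z" "\<Psi> Z" "\<Psi>' Z" by (rule wave[OF Z])
  let ?d = "\<lambda>x. \<Psi> Z x - \<Psi> 0 x" and ?d' = "\<lambda>x. \<Psi>' Z x - \<Psi>' 0 x"
  let ?q = "\<lambda>x. \<omega> - ((\<Psi> Z x)\<^sup>2 + \<Psi> Z x * \<Psi> 0 x + (\<Psi> 0 x)\<^sup>2)"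
  have "(?d x)\<^sup>2 + (?d' x)\<^sup>2 \<le> ((?d L)\<^sup>2 + (?d' L)\<^sup>2 + 0\<^sup>2) * exp ((7 * \<omega> + 2) * L)"
  proof (rule second_order_bound[where q = ?q and r = "\<lambda>_. 0"])
    fix t
    show "(?d has_real_derivative ?d' t) (at t)"
      by (auto intro!: derivative_eq_intros deriv_wave w0.deriv_wave)
    have "(?d' has_real_derivative (\<omega> * \<Psi> Z t - (\<Psi> Z t)^3) - (\<omega> * \<Psi> 0 t - (\<Psi> 0 t)^3)) (at t)"
      by (auto intro!: derivative_eq_intros deriv2_wave w0.deriv2_wave)
    then show "(?d' has_real_derivative ?q t * ?d t + 0) (at t)"
      by (simp add: algebra_simps power2_eq_square power3_eq_cube)
    have "\<bar>\<Psi> Z t * \<Psi> 0 t\<bar> \<le> sqrt (2 * \<omega>) * sqrt (2 * \<omega>)"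
      unfolding abs_mult using Psi_le[OF Z, of t] Psi_le[of 0 t] Z0 \<omega> by (intro mult_mono) auto
    also have "\<dots> = 2 * \<omega>" using \<omega> by simp
    finally show "\<bar>?q t\<bar> \<le> 7 * \<omega>"
      using sq_le[of t] w0.sq_le[of t] pos[of t] w0.pos[of t] mult_pos_pos[OF pos[of t] w0.pos[of t]]
        zero_le_power2[of "\<Psi> Z t"] zero_le_power2[of "\<Psi> 0 t"] by linarith
  qed (use \<omega> x in \<open>auto intro!: continuous_intros continuous_at_imp_continuous_on isCont_wave w0.isCont_wave\<close>)
  also have "\<dots> = (?d L)\<^sup>2 * exp ((7 * \<omega> + 2) * L)" by (simp add: deriv_L w0.deriv_L)
  also have "\<dots> \<le> (?d L)\<^sup>2 * (C * C)"
  proof (intro mult_left_mono)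
    have "exp ((7 * \<omega> + 2) * L) \<le> 1 * C" using L by (simp add: C_def)
    also have "\<dots> \<le> C * C" using C_ge_1 by (intro mult_right_mono) auto
    finally show "exp ((7 * \<omega> + 2) * L) \<le> C * C" .
  qed auto
  also have "\<dots> = (C * \<bar>?d L\<bar>)\<^sup>2" by (simp add: power2_eq_square mult_ac)
  finally show "\<bar>?d x\<bar> \<le> C * \<bar>?d L\<bar>" "\<bar>?d' x\<bar> \<le> C * \<bar>?d L\<bar>"
    using C_ge_1 by (auto intro: abs_le_of_sum_squares_le)
qed

lemma tendsto_amplitude: "((\<lambda>Z. \<bar>\<Psi> Z L - \<Psi> 0 L\<bar>) \<longlongrightarrow> 0) (nhds 0)"
proof -
  have "((\<lambda>Z. \<Psi> Z L) \<longlongrightarrow> \<Psi> 0 L) (nhds 0)"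
    using lim tendsto_at_iff_tendsto_nhds[of "\<lambda>Z. \<Psi> Z L" 0] by simp
  then have "((\<lambda>Z. \<bar>\<Psi> Z L - \<Psi> 0 L\<bar>) \<longlongrightarrow> \<bar>\<Psi> 0 L - \<Psi> 0 L\<bar>) (nhds 0)"
    by (intro tendsto_intros)
  then show ?thesis by simp
qed

lemma eventually_domain: "\<forall>\<^sub>F p in near. fst p \<in> {-Z0<..<Z0}"
proof -
  have "\<forall>\<^sub>F Z in nhds 0. Z \<in> {-Z0<..<Z0}" using Z0 by (intro eventually_nhds_in_open) auto
  then show ?thesis by (rule eventually_compose_filterlim) (rule filterlim_fst)
qed

lemma eventually_wave_close:
  assumes "0 < \<epsilon>"
  shows "\<forall>\<^sub>F p in near. \<forall>x\<in>{0..L}. \<bar>\<Psi>' (fst p) x - \<Psi>' 0 x\<bar> \<le> \<epsilon>"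
proof -
  have "((\<lambda>Z. C * \<bar>\<Psi> Z L - \<Psi> 0 L\<bar>) \<longlongrightarrow> C * 0) (nhds 0)"
    by (intro tendsto_intros tendsto_amplitude)
  then have "\<forall>\<^sub>F Z in nhds 0. C * \<bar>\<Psi> Z L - \<Psi> 0 L\<bar> < \<epsilon>"
    using assms by (auto dest: order_tendstoD)
  then have "\<forall>\<^sub>F p in near. C * \<bar>\<Psi> (fst p) L - \<Psi> 0 L\<bar> < \<epsilon>"
    by (rule eventually_compose_filterlim) (rule filterlim_fst)
  with eventually_domain show ?thesis
    by eventually_elim (use Psi_close(2) in fastforce)
qed

lemma eventually_potential_close:
  assumes "0 < \<epsilon>"
  shows "\<forall>\<^sub>F p in near. \<forall>x\<in>{0..L}. \<bar>q (fst p) (snd p) x - q 0 0 x\<bar> \<le> \<epsilon>"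
proof -
  \<comment> \<open>Bounds the change of the potential, by
    \<open>a\<^sup>2 - b\<^sup>2 = (a - b) * (a + b)\<close>.\<close>
  define B where "B = (\<lambda>p. 3 * (C * \<bar>\<Psi> (fst p) L - \<Psi> 0 L\<bar>) * (2 * sqrt (2 * \<omega>)) + \<bar>snd p\<bar>)"
  have "((\<lambda>p. \<bar>\<Psi> (fst p) L - \<Psi> 0 L\<bar>) \<longlongrightarrow> 0) near"
    by (rule filterlim_compose[OF tendsto_amplitude filterlim_fst])
  moreover have "(snd \<longlongrightarrow> 0) near" by (rule filterlim_snd)
  ultimately have "(B \<longlongrightarrow> 3 * (C * 0) * (2 * sqrt (2 * \<omega>)) + \<bar>0\<bar>) near"
    unfolding B_def by (intro tendsto_intros)
  then have "\<forall>\<^sub>F p in near. B p < \<epsilon>" using assms by (auto dest: order_tendstoD)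
  with eventually_domain show ?thesis
  proof eventually_elim
    case (elim p)
    show ?case
    proof
      fix x assume x: "x \<in> {0..L}"
      let ?Z = "fst p"
      have "\<bar>\<Psi> ?Z x + \<Psi> 0 x\<bar> \<le> 2 * sqrt (2 * \<omega>)"
        using Psi_le[OF elim(1), of x] Psi_le[of 0 x] Z0 by auto
      then have "\<bar>\<Psi> ?Z x - \<Psi> 0 x\<bar> * \<bar>\<Psi> ?Z x + \<Psi> 0 x\<bar> \<le> (C * \<bar>\<Psi> ?Z L - \<Psi> 0 L\<bar>) * (2 * sqrt (2 * \<omega>))"
        using Psi_close(1)[OF elim(1) x] by (intro mult_mono) (use C_ge_1 in auto)
      moreover have "q ?Z (snd p) x - q 0 0 x = - 3 * ((\<Psi> ?Z x - \<Psi> 0 x) * (\<Psi> ?Z x + \<Psi> 0 x)) - snd p"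
        by (simp add: q_def algebra_simps power2_eq_square)
      ultimately have "\<bar>q ?Z (snd p) x - q 0 0 x\<bar> \<le> B p"
        unfolding B_def abs_mult[symmetric] by linarith
      then show "\<bar>q ?Z (snd p) x - q 0 0 x\<bar> \<le> \<epsilon>" using elim(2) by simp
    qed
  qed
qed

text \<open>Stated for every solution with the data of \<open>y0\<close> at \<open>L\<close>, so
  that it applies to whatever solution an eigenvalue supplies.\<close>

lemma eventually_solution_close:
  assumes y0: "ode_sol L (q 0 0) y0 y0'" and "0 < \<epsilon>"
  shows "\<forall>\<^sub>F p in near. \<forall>y y'. ode_sol L (q (fst p) (snd p)) y y' \<and> y L = y0 L \<and> y' L = y0' L \<longrightarrow>
    (\<forall>x\<in>{0..L}. \<bar>y x - y0 x\<bar> \<le> \<epsilon> \<and> \<bar>y' x - y0' x\<bar> \<le> \<epsilon>)"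
proof -
  obtain M where M: "0 \<le> M" "\<And>x. x \<in> {0..L} \<Longrightarrow> \<bar>y0 x\<bar> \<le> M"
    using y0 continuous_on_interval_bounded[of 0 L y0] unfolding ode_sol_def by blast
  \<comment> \<open>\<open>M + 1\<close> keeps the denominator positive, and the minimum with 1
    meets the smallness condition of \<open>ode_sol_perturb\<close>.\<close>
  define \<delta> where "\<delta> = min 1 (\<epsilon> / (C * (M + 1)))"
  have "0 < \<delta>" using \<open>0 < \<epsilon>\<close> M C_ge_1 by (simp add: \<delta>_def)
  have "C * (M * \<delta>) \<le> C * ((M + 1) * (\<epsilon> / (C * (M + 1))))"
    using M \<open>0 < \<delta>\<close> C_ge_1 by (intro mult_left_mono mult_mono) (auto simp: \<delta>_def)
  also have "\<dots> = (C * (M + 1)) * (\<epsilon> / (C * (M + 1)))" by (simp only: mult.assoc)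
  also have "\<dots> = \<epsilon>" using M C_ge_1 by simp
  finally have le: "C * (M * \<delta>) \<le> \<epsilon>" .
  show ?thesis
    using eventually_potential_close[OF \<open>0 < \<delta>\<close>]
  proof eventually_elim
    case (elim p)
    show ?case
    proof (intro allI impI, elim conjE)
      fix y y' assume y: "ode_sol L (q (fst p) (snd p)) y y'" "y L = y0 L" "y' L = y0' L"
      show "\<forall>x\<in>{0..L}. \<bar>y x - y0 x\<bar> \<le> \<epsilon> \<and> \<bar>y' x - y0' x\<bar> \<le> \<epsilon>"
      proof
        fix x assume x: "x \<in> {0..L}"
        have "(y x - y0 x)\<^sup>2 + (y' x - y0' x)\<^sup>2 \<le> (\<delta> * M)\<^sup>2 * exp ((7 * \<omega> + 3) * L)"
        proof (rule ode_sol_perturb[OF y(1) y0 y(2,3)])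
          show "\<bar>q 0 0 t\<bar> \<le> 7 * \<omega>" for t
            unfolding q_def abs_le_iff using w0.sq_le[of t] zero_le_power2[of "\<Psi> 0 t"] \<omega> by linarith
        qed (use elim M x \<omega> in \<open>auto simp: \<delta>_def\<close>)
        also have "\<dots> \<le> (\<delta> * M)\<^sup>2 * (C * C)"
          using mult_right_mono[OF C_ge_1, of C] C_ge_1 by (intro mult_left_mono) (auto simp: C_def[symmetric])
        also have "\<dots> = (C * (M * \<delta>))\<^sup>2" by (simp add: power2_eq_square mult_ac)
        finally have "\<bar>y x - y0 x\<bar> \<le> C * (M * \<delta>)" "\<bar>y' x - y0' x\<bar> \<le> C * (M * \<delta>)"
          using C_ge_1 M \<open>0 < \<delta>\<close> by (auto intro: abs_le_of_sum_squares_le)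
        then show "\<bar>y x - y0 x\<bar> \<le> \<epsilon> \<and> \<bar>y' x - y0' x\<bar> \<le> \<epsilon>" using le by linarith
      qed
    qed
  qed
qed

section \<open>The wave at \<open>Z = 0\<close> and the failure of the even boundary
  condition\<close>

lemma deriv_odd_0: "\<Psi>' 0 (- x) = - \<Psi>' 0 x"
proof -
  have "(uminus has_real_derivative - 1) (at x)" by (auto intro!: derivative_eq_intros)
  from DERIV_chain2[OF w0.deriv_wave this]
  have "(\<Psi> 0 has_real_derivative - \<Psi>' 0 (- x)) (at x)" by (simp add: even_0)
  from DERIV_unique[OF this w0.deriv_wave] show ?thesis by simp
qed

text \<open>The reflections about 0 and about \<open>L\<close> compose to the translation by
  \<open>2 * L\<close>.\<close>

lemma wave_periodic_0: "\<Psi> 0 (x + 2 * L) = \<Psi> 0 x" "\<Psi>' 0 (x + 2 * L) = \<Psi>' 0 x"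
  using w0.reflect[of "- x"] w0.deriv_reflect[of "- x"] by (simp_all add: even_0 deriv_odd_0 add.commute)

lemma curvature_0: "0 < \<omega> * \<Psi> 0 L - (\<Psi> 0 L)^3" "\<omega> * \<Psi> 0 0 - (\<Psi> 0 0)^3 < 0"
  using mult_strict_right_mono[OF min_0 w0.pos[of L]] mult_strict_right_mono[OF max_0 w0.pos[of 0]]
  by (auto simp: power2_eq_square power3_eq_cube mult_ac)

lemma ode_sol_q_0:
  assumes "\<And>x. (v has_real_derivative v' x) (at x)"
    "\<And>x. (v' has_real_derivative (\<omega> - 3 * (\<Psi> 0 x)\<^sup>2) * v x) (at x)"
  shows "ode_sol L (q 0 0) (\<lambda>x. v x / c) (\<lambda>x. v' x / c)"
proof -
  have "isCont v x" "isCont v' x" for x using assms DERIV_isCont by blast+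
  then show ?thesis
    unfolding ode_sol_def q_def divide_inverse
    by (auto intro!: continuous_intros continuous_at_imp_continuous_on derivative_eq_intros assms
        simp: mult_ac)
qed

text \<open>The solution even about \<open>L\<close> is the explicit second solution
  \<open>v\<close>. If \<open>v' 0 = 0\<close>, then \<open>G 0 = 0\<close>, hence \<open>G\<close>
  and \<open>v\<close> are periodic and \<open>v\<close> lies in the kernel next to
  \<open>\<Psi>'\<close>. Simplicity makes them proportional, but \<open>v L > 0\<close> and
  \<open>\<Psi>' L = 0\<close>.\<close>

lemma even_kernel_trivial:
  assumes mult: "eig_multiplicity (L1_graph L \<omega> 0 (\<phi> 0)) 0 = 1"
  obtains y y' where "ode_sol L (q 0 0) y y'" "y L = 1" "y' L = 0" "y' 0 \<noteq> 0"
proof -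
  obtain v v' G where v: "\<And>x. (v has_real_derivative v' x) (at x)"
    "\<And>x. (v' has_real_derivative (\<omega> - 3 * (\<Psi> 0 x)\<^sup>2) * v x) (at x)"
    and vL: "v L = \<Psi> 0 L * (\<omega> - (\<Psi> 0 L)\<^sup>2) * (2 * \<omega> - (\<Psi> 0 L)\<^sup>2)" "v' L = 0"
    and v_eq: "\<And>x. v x = 2 * ((\<Psi> 0 L)^4 / 2 - \<omega> * (\<Psi> 0 L)\<^sup>2 + \<omega>\<^sup>2) * \<Psi> 0 x - \<omega> * (\<Psi> 0 x)^3 + \<Psi>' 0 x * G x"
    and G: "\<And>x. (G has_real_derivative 2 * ((\<Psi> 0 L)^4 / 2 - \<omega> * (\<Psi> 0 L)\<^sup>2) + \<omega> * (\<Psi> 0 x)\<^sup>2) (at x)"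
    and GL: "G L = 0" and v'_0: "v' 0 = (2 * ((\<Psi> 0 L)^4 - 2 * \<omega> * (\<Psi> 0 L)\<^sup>2) + 2 * \<omega>\<^sup>2 - 2 * \<omega> * (\<Psi> 0 0)\<^sup>2) * \<Psi>' 0 0
      + (\<omega> * \<Psi> 0 0 - (\<Psi> 0 0)^3) * G 0"
    by (rule w0.linearised_second_solution, rule that)
  have "v L > 0" unfolding vL using w0.pos[of L] min_0 \<omega> by (intro mult_pos_pos) auto
  have "v' 0 \<noteq> 0"
  proof
    assume "v' 0 = 0"
    then have G0: "G 0 = 0" using v'_0 w0.deriv_0 curvature_0 by simp
    \<comment> \<open>\<open>G\<close> is odd about \<open>L\<close>, as its derivative is symmetric
      about \<open>L\<close>.\<close>
    have "G x + G (2 * L - x) = G L + G (2 * L - L)" for x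
    proof (rule DERIV_isconst_all[of "\<lambda>x. G x + G (2 * L - x)"], rule allI)
      fix t
      have "((\<lambda>x. 2 * L - x) has_real_derivative - 1) (at t)" by (auto intro!: derivative_eq_intros)
      from DERIV_add[OF G DERIV_chain2[OF G this]]
      show "((\<lambda>x. G x + G (2 * L - x)) has_real_derivative 0) (at t)"
        by (simp add: w0.reflect)
    qed
    from this[of 0] have G2L: "G (2 * L) = 0" using G0 GL by simp
    \<comment> \<open>The derivative of \<open>G\<close> is periodic, so the increment of
      \<open>G\<close> over a period is constant; it is 0 between \<open>0\<close> and
      \<open>2 * L\<close>.\<close>
    have "G (x + 2 * L) - G x = G (0 + 2 * L) - G 0" for x
    proof (rule DERIV_isconst_all[of "\<lambda>x. G (x + 2 * L) - G x"], rule allI)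
      fix t
      have "((\<lambda>x. x + 2 * L) has_real_derivative 1) (at t)" by (auto intro!: derivative_eq_intros)
      from DERIV_diff[OF DERIV_chain2[OF G this] G]
      show "((\<lambda>x. G (x + 2 * L) - G x) has_real_derivative 0) (at t)"
        by (simp add: wave_periodic_0)
    qed
    then have "G (x + 2 * L) = G x" for x using G0 G2L by simp
    then have "v (x + 2 * L) = v x" for x by (simp add: v_eq wave_periodic_0)
    moreover have "isCont v x" for x using v(1) by (rule DERIV_isCont)
    ultimately have 1: "(\<lambda>x. complex_of_real (v x)) \<in> eigenspace (L1_graph L \<omega> 0 (\<phi> 0)) 0"
      by (intro eigenspaceI_smooth[OF v])
        (auto simp: profile_0 intro!: continuous_at_imp_continuous_on continuous_intros w0.isCont_wave)
    have 2: "(\<lambda>x. complex_of_real (\<Psi>' 0 x)) \<in> eigenspace (L1_graph L \<omega> 0 (\<phi> 0)) 0"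
      by (intro eigenspaceI_smooth[OF w0.linearised_deriv])
        (auto simp: profile_0 wave_periodic_0 intro!: continuous_at_imp_continuous_on continuous_intros w0.isCont_wave)
    have "(\<lambda>x. complex_of_real (\<Psi>' 0 x)) \<noteq> 0"
    proof
      assume "(\<lambda>x. complex_of_real (\<Psi>' 0 x)) = 0"
      then have "\<Psi>' 0 = (\<lambda>_. 0)" by (auto simp: fun_eq_iff)
      then have "((\<lambda>_. 0) has_real_derivative \<omega> * \<Psi> 0 L - (\<Psi> 0 L)^3) (at L)"
        using w0.linearised_deriv(1)[of L] by simp
      from DERIV_unique[OF this DERIV_const] curvature_0 show False by simp
    qed
    with mult 1 2 obtain c where "(\<lambda>x. complex_of_real (v x)) = (\<lambda>x. c * complex_of_real (\<Psi>' 0 x))"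
      by (metis eig_multiplicity_1_dependent)
    then have "complex_of_real (v L) = c * complex_of_real (\<Psi>' 0 L)" by (rule fun_cong)
    with \<open>v L > 0\<close> show False by (simp add: w0.deriv_L)
  qed
  with \<open>v L > 0\<close> vL show ?thesis
    by (intro that[OF ode_sol_q_0[OF v, of "v L"]]) auto
qed

text \<open>Near the origin \<open>v' 0\<close> stays close to \<open>y' 0 \<noteq> 0\<close>,
  whereas the boundary condition forces it to be of the order of \<open>Z\<close>.\<close>

lemma eventually_no_even_eigenfunction:
  assumes "eig_multiplicity (L1_graph L \<omega> 0 (\<phi> 0)) 0 = 1"
  shows "\<forall>\<^sub>F p in near. \<not> (\<exists>v v'. ode_sol L (q (fst p) (snd p)) v v' \<and> v L = 1 \<and> v' L = 0 \<and>
    v' 0 + fst p / 2 * v 0 = 0)"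
proof -
  obtain y y' where y: "ode_sol L (q 0 0) y y'" "y L = 1" "y' L = 0" "y' 0 \<noteq> 0"
    using even_kernel_trivial[OF assms] .
  define \<epsilon> where "\<epsilon> = \<bar>y' 0\<bar> / 2"
  have "0 < \<epsilon>" using y by (simp add: \<epsilon>_def)
  have "((\<lambda>p. \<bar>fst p\<bar> / 2 * (\<bar>y 0\<bar> + \<epsilon>)) \<longlongrightarrow> \<bar>0\<bar> / 2 * (\<bar>y 0\<bar> + \<epsilon>)) near"
    by (intro tendsto_intros filterlim_fst) auto
  then have "\<forall>\<^sub>F p in near. \<bar>fst p\<bar> / 2 * (\<bar>y 0\<bar> + \<epsilon>) < \<epsilon>"
    using \<open>0 < \<epsilon>\<close> by (auto dest: order_tendstoD)
  then show ?thesis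
    using eventually_solution_close[OF y(1) \<open>0 < \<epsilon>\<close>]
  proof eventually_elim
    case (elim p)
    show ?case
    proof safe
      fix v v' assume v: "ode_sol L (q (fst p) (snd p)) v v'" "v L = 1" "v' L = 0"
        "v' 0 + fst p / 2 * v 0 = 0"
      then have close: "\<bar>v 0 - y 0\<bar> \<le> \<epsilon>" "\<bar>v' 0 - y' 0\<bar> \<le> \<epsilon>" using elim(2) y L by auto
      have "\<bar>v' 0\<bar> = \<bar>fst p\<bar> / 2 * \<bar>v 0\<bar>" using v(4) by (simp add: abs_mult eq_neg_iff_add_eq_0[symmetric])
      also have "\<dots> \<le> \<bar>fst p\<bar> / 2 * (\<bar>y 0\<bar> + \<epsilon>)" using close by (intro mult_left_mono) auto
      also have "\<dots> < \<epsilon>" by (rule elim(1))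
      finally have "\<bar>v' 0\<bar> < \<epsilon>" .
      then show False using close \<epsilon>_def by linarith
    qed
  qed
qed

section \<open>Odd eigenfunctions: uniqueness and sign of the eigenvalue\<close>

definition odd_sol :: "real \<Rightarrow> real \<Rightarrow> (real \<Rightarrow> real) \<Rightarrow> (real \<Rightarrow> real) \<Rightarrow> bool" where
  "odd_sol Z \<nu> w w' \<longleftrightarrow> ode_sol L (q Z \<nu>) w w' \<and> w L = 0 \<and> w' L = 1 \<and> w 0 = 0"

lemma eventually_eigenfunction_odd:
  assumes "eig_multiplicity (L1_graph L \<omega> 0 (\<phi> 0)) 0 = 1"
  shows "\<forall>\<^sub>F p in near. eigenvalue (L1_graph L \<omega> (fst p) (\<phi> (fst p))) (snd p) \<longrightarrow>
    (\<exists>w w'. odd_sol (fst p) (snd p) w w')"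
  using eventually_no_even_eigenfunction[OF assms] eventually_domain
proof eventually_elim
  case (elim p)
  then show ?case
    using eigenvalue_shooting[OF wave L, of "fst p" "snd p"] unfolding odd_sol_def q_def by blast
qed

text \<open>The second derivative of the wave at \<open>L\<close> for \<open>Z = 0\<close>. Dividing
  \<open>\<Psi>' 0\<close> by it gives slope 1 at \<open>L\<close>, the normalisation of
  \<open>odd_sol\<close>.\<close>

definition \<kappa> :: real where "\<kappa> = \<omega> * \<Psi> 0 L - (\<Psi> 0 L)^3"

lemma eventually_odd_close:
  assumes "0 < \<epsilon>"
  shows "\<forall>\<^sub>F p in near. \<forall>w w'. odd_sol (fst p) (snd p) w w' \<longrightarrow>
    (\<forall>x\<in>{0..L}. \<bar>w x - \<Psi>' 0 x / \<kappa>\<bar> \<le> \<epsilon> \<and> \<bar>w' x - (\<omega> * \<Psi> 0 x - (\<Psi> 0 x)^3) / \<kappa>\<bar> \<le> \<epsilon>)"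
  using eventually_solution_close[OF ode_sol_q_0[OF w0.linearised_deriv, of \<kappa>] assms]
  by eventually_elim (use curvature_0 in \<open>auto simp: odd_sol_def w0.deriv_L \<kappa>_def\<close>)

text \<open>Otherwise the wave would be constant on \<open>[0, L]\<close>, against
  \<open>min_0\<close> and \<open>max_0\<close>.\<close>

lemma integral_deriv_sq_pos: "0 < integral {0..L} (\<lambda>x. \<Psi>' 0 x * \<Psi>' 0 x)"
proof -
  let ?f = "\<lambda>x. \<Psi>' 0 x * \<Psi>' 0 x"
  have cont: "continuous_on {0..L} ?f"
    by (intro continuous_intros continuous_at_imp_continuous_on ballI w0.isCont_wave)
  have "0 \<le> integral {0..L} ?f"
    by (intro integral_nonneg integrable_continuous_real cont) auto
  moreover have "integral {0..L} ?f \<noteq> 0"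
  proof
    assume "integral {0..L} ?f = 0"
    then have zero: "\<Psi>' 0 x = 0" if "x \<in> {0..L}" for x
      using integral_eq_0_iff[OF cont L] that by auto
    have "\<Psi> 0 L = \<Psi> 0 0"
    proof (rule DERIV_isconst_end[OF L])
      show "continuous_on {0..L} (\<Psi> 0)" by (intro continuous_at_imp_continuous_on ballI w0.isCont_wave)
      show "(\<Psi> 0 has_real_derivative 0) (at x)" if "0 < x" "x < L" for x
        using w0.deriv_wave[of x] zero[of x] that by simp
    qed
    with min_0 max_0 show False by simp
  qed
  ultimately show ?thesis by simp
qed

text \<open>In Green's identity for \<open>w1\<close> and \<open>w2\<close> all boundary terms
  vanish, so \<open>(\<nu>2 - \<nu>1)\<close> times the integral of \<open>w1 * w2\<close> is 0.
  That integral is positive because both factors are close to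
  \<open>\<Psi>' 0 / \<kappa>\<close>.\<close>

lemma odd_sol_unique:
  "\<exists>\<epsilon>>0. \<forall>Z \<nu>1 \<nu>2 w1 w1' w2 w2'. odd_sol Z \<nu>1 w1 w1' \<and> odd_sol Z \<nu>2 w2 w2' \<and>
     (\<forall>x\<in>{0..L}. \<bar>w1 x - \<Psi>' 0 x / \<kappa>\<bar> \<le> \<epsilon> \<and> \<bar>w2 x - \<Psi>' 0 x / \<kappa>\<bar> \<le> \<epsilon>) \<longrightarrow> \<nu>1 = \<nu>2"
proof -
  let ?w = "\<lambda>x. \<Psi>' 0 x / \<kappa>"
  have "0 < \<kappa>" using curvature_0 by (simp add: \<kappa>_def)
  have cont: "continuous_on {0..L} ?w"
    using \<open>0 < \<kappa>\<close> by (intro continuous_intros continuous_at_imp_continuous_on ballI w0.isCont_wave) auto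
  obtain M where M: "0 \<le> M" "\<And>x. x \<in> {0..L} \<Longrightarrow> \<bar>?w x\<bar> \<le> M"
    using continuous_on_interval_bounded[OF cont] by blast
  define I where "I = integral {0..L} (\<lambda>x. ?w x * ?w x)"
  have "I = integral {0..L} (\<lambda>x. (1 / (\<kappa> * \<kappa>)) * (\<Psi>' 0 x * \<Psi>' 0 x))" by (simp add: I_def)
  also have "\<dots> = (1 / (\<kappa> * \<kappa>)) * integral {0..L} (\<lambda>x. \<Psi>' 0 x * \<Psi>' 0 x)"
    by (rule integral_mult_right)
  finally have "0 < I" using integral_deriv_sq_pos \<open>0 < \<kappa>\<close> by simp
  \<comment> \<open>Keeps the error term of \<open>integral_product_close\<close> below
    \<open>I / 2\<close>.\<close>
  define \<epsilon> where "\<epsilon> = min 1 (I / (2 * ((2 * M + 1) * L)))"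
  have "0 < \<epsilon>" using \<open>0 < I\<close> M L by (simp add: \<epsilon>_def)
  have "(2 * M + 1) * \<epsilon> * L \<le> ((2 * M + 1) * L) * (I / (2 * ((2 * M + 1) * L)))"
    using M L mult_left_mono[of \<epsilon> "I / (2 * ((2 * M + 1) * L))" "(2 * M + 1) * L"] by (simp add: \<epsilon>_def mult_ac)
  also have "\<dots> = I / 2" using M L by (intro cancel_half) simp
  finally have small: "(2 * M + 1) * \<epsilon> * L < I" using \<open>0 < I\<close> by linarith
  have "\<nu>1 = \<nu>2" if w: "odd_sol Z \<nu>1 w1 w1'" "odd_sol Z \<nu>2 w2 w2'"
    and close: "\<forall>x\<in>{0..L}. \<bar>w1 x - ?w x\<bar> \<le> \<epsilon> \<and> \<bar>w2 x - ?w x\<bar> \<le> \<epsilon>" for Z \<nu>1 \<nu>2 w1 w1' w2 w2'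
  proof -
    have "I - (2 * M + 1) * \<epsilon> * L \<le> integral {0..L} (\<lambda>x. w1 x * w2 x)"
      unfolding I_def
      by (rule integral_product_close) (use w close M L cont in \<open>auto simp: odd_sol_def ode_sol_def \<epsilon>_def\<close>)
    then have "0 < integral {0..L} (\<lambda>x. w1 x * w2 x)" using small by linarith
    moreover have "(w1' L * w2 L - w1 L * w2' L) - (w1' 0 * w2 0 - w1 0 * w2' 0)
        = (\<nu>2 - \<nu>1) * integral {0..L} (\<lambda>x. w1 x * w2 x)"
      using w L by (intro wronskian_integral[of L "q Z \<nu>1" _ _ "q Z \<nu>2"]) (auto simp: odd_sol_def q_def)
    ultimately show "\<nu>1 = \<nu>2" using w by (simp add: odd_sol_def)
  qed
  with \<open>0 < \<epsilon>\<close> show ?thesis by blast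
qed

text \<open>Green's identity of \<open>w\<close> with \<open>\<Psi>' Z\<close> leaves a single
  boundary term, at the defect. It equates a positive multiple of \<open>\<nu>\<close> with a
  positive multiple of \<open>Z\<close>.\<close>

lemma eventually_odd_sign:
  "\<forall>\<^sub>F p in near. \<forall>w w'. odd_sol (fst p) (snd p) w w' \<longrightarrow> sgn (snd p) = sgn (fst p)"
proof -
  let ?w = "\<lambda>x. \<Psi>' 0 x / \<kappa>"
  have "0 < \<kappa>" using curvature_0 by (simp add: \<kappa>_def)
  have cont: "continuous_on {0..L} ?w" "continuous_on {0..L} (\<Psi>' 0)"
    using \<open>0 < \<kappa>\<close> by (intro continuous_intros continuous_at_imp_continuous_on ballI w0.isCont_wave; simp)+
  obtain M1 where M1: "0 \<le> M1" "\<And>x. x \<in> {0..L} \<Longrightarrow> \<bar>?w x\<bar> \<le> M1"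
    using continuous_on_interval_bounded[OF cont(1)] by blast
  obtain M2 where M2: "0 \<le> M2" "\<And>x. x \<in> {0..L} \<Longrightarrow> \<bar>\<Psi>' 0 x\<bar> \<le> M2"
    using continuous_on_interval_bounded[OF cont(2)] by blast
  define M where "M = max M1 M2"
  have M: "0 \<le> M" "\<And>x. x \<in> {0..L} \<Longrightarrow> \<bar>?w x\<bar> \<le> M" "\<And>x. x \<in> {0..L} \<Longrightarrow> \<bar>\<Psi>' 0 x\<bar> \<le> M"
    using M1 M2 unfolding M_def by fastforce+
  define I where "I = integral {0..L} (\<lambda>x. ?w x * \<Psi>' 0 x)"
  have "I = integral {0..L} (\<lambda>x. (1 / \<kappa>) * (\<Psi>' 0 x * \<Psi>' 0 x))" by (simp add: I_def)
  also have "\<dots> = (1 / \<kappa>) * integral {0..L} (\<lambda>x. \<Psi>' 0 x * \<Psi>' 0 x)"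
    by (rule integral_mult_right)
  finally have "0 < I" using integral_deriv_sq_pos \<open>0 < \<kappa>\<close> by simp
  \<comment> \<open>Minus the slope at 0 of the limiting odd solution
    \<open>\<Psi>' 0 / \<kappa>\<close>; the bound \<open>\<epsilon> \<le> s / 2\<close> keeps
    \<open>w' 0\<close> negative.\<close>
  define s where "s = - ((\<omega> * \<Psi> 0 0 - (\<Psi> 0 0)^3) / \<kappa>)"
  have "0 < s" using curvature_0 \<open>0 < \<kappa>\<close> by (simp add: s_def divide_neg_pos)
  define \<epsilon> where "\<epsilon> = min (min 1 (s / 2)) (I / (2 * ((2 * M + 1) * L)))"
  have "0 < \<epsilon>" using \<open>0 < I\<close> \<open>0 < s\<close> M L by (simp add: \<epsilon>_def)
  have "(2 * M + 1) * \<epsilon> * L \<le> ((2 * M + 1) * L) * (I / (2 * ((2 * M + 1) * L)))"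
    using M L mult_left_mono[of \<epsilon> "I / (2 * ((2 * M + 1) * L))" "(2 * M + 1) * L"] by (simp add: \<epsilon>_def mult_ac)
  also have "\<dots> = I / 2" using M L by (intro cancel_half) simp
  finally have small: "(2 * M + 1) * \<epsilon> * L < I" using \<open>0 < I\<close> by linarith
  show ?thesis
    using eventually_odd_close[OF \<open>0 < \<epsilon>\<close>] eventually_wave_close[OF \<open>0 < \<epsilon>\<close>] eventually_domain
  proof eventually_elim
    case (elim p)
    define Z where "Z = fst p"
    define \<nu> where "\<nu> = snd p"
    interpret stationary_wave L \<omega> Z "\<phi> Z" "\<Psi> Z" "\<Psi>' Z" using wave elim(3) by (simp add: Z_def)
    show ?case
    proof (intro allI impI)
      fix w w' assume w: "odd_sol (fst p) (snd p) w w'"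
      have close: "\<bar>w x - ?w x\<bar> \<le> \<epsilon>" "\<bar>\<Psi>' Z x - \<Psi>' 0 x\<bar> \<le> \<epsilon>"
          "\<bar>w' x - (\<omega> * \<Psi> 0 x - (\<Psi> 0 x)^3) / \<kappa>\<bar> \<le> \<epsilon>" if "x \<in> {0..L}" for x
        using elim w that by (auto simp: Z_def)
      have "w' 0 + s = w' 0 - (\<omega> * \<Psi> 0 0 - (\<Psi> 0 0)^3) / \<kappa>" unfolding s_def by linarith
      then have "\<bar>w' 0 + s\<bar> \<le> \<epsilon>" using close(3)[of 0] L by simp
      moreover have "\<epsilon> \<le> s / 2" unfolding \<epsilon>_def by linarith
      ultimately have "w' 0 < 0" using \<open>0 < s\<close> by linarith
      have sol: "ode_sol L (q Z \<nu>) w w'" and bc: "w L = 0" "w 0 = 0"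
        using w by (auto simp: odd_sol_def Z_def \<nu>_def)
      let ?J = "integral {0..L} (\<lambda>x. w x * \<Psi>' Z x)"
      have "I - (2 * M + 1) * \<epsilon> * L \<le> ?J"
        unfolding I_def
        by (rule integral_product_close)
          (use sol close M L cont isCont_wave in \<open>auto simp: ode_sol_def \<epsilon>_def intro!: continuous_at_imp_continuous_on\<close>)
      then have "0 < ?J" using small by linarith
      have "(w' L * \<Psi>' Z L - w L * (\<omega> * \<Psi> Z L - (\<Psi> Z L)^3)) - (w' 0 * \<Psi>' Z 0 - w 0 * (\<omega> * \<Psi> Z 0 - (\<Psi> Z 0)^3))
          = - \<nu> * ?J"
        using L by (intro wronskian_integral[OF sol ode_sol_wave_deriv]) (auto simp: q_def)
      \<comment> \<open>The surviving term \<open>w' 0 * \<Psi>' Z 0\<close> is rewritten by the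
        half jump condition \<open>\<Psi>' Z 0 = - (Z / 2) * \<Psi> Z 0\<close>.\<close>
      then have "\<nu> * ?J = - w' 0 * \<Psi> Z 0 / 2 * Z"
        by (simp add: bc deriv_L deriv_0 algebra_simps)
      then have "sgn (\<nu> * ?J) = sgn (- w' 0 * \<Psi> Z 0 / 2 * Z)" by simp
      moreover have "0 < - w' 0 * \<Psi> Z 0 / 2" using \<open>w' 0 < 0\<close> pos[of 0] by (simp add: mult_neg_pos)
      ultimately show "sgn (snd p) = sgn (fst p)"
        using \<open>0 < ?J\<close> unfolding sgn_mult by (simp add: Z_def \<nu>_def)
    qed
  qed
qed

text \<open>Combines the eventual statements into one \<open>\<delta>\<close>. A neighbourhood in
  the product filter contains a rectangle, so two small eigenvalues for the same \<open>Z\<close>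
  are covered at once and can be compared.\<close>

lemma small_eigenvalues:
  assumes "eig_multiplicity (L1_graph L \<omega> 0 (\<phi> 0)) 0 = 1"
  obtains \<delta> where "0 < \<delta>"
    "\<And>Z \<nu>. \<bar>Z\<bar> < \<delta> \<Longrightarrow> \<bar>\<nu>\<bar> < \<delta> \<Longrightarrow> eigenvalue (L1_graph L \<omega> Z (\<phi> Z)) \<nu> \<Longrightarrow> sgn \<nu> = sgn Z"
    "\<And>Z \<nu>1 \<nu>2. \<bar>Z\<bar> < \<delta> \<Longrightarrow> \<bar>\<nu>1\<bar> < \<delta> \<Longrightarrow> \<bar>\<nu>2\<bar> < \<delta> \<Longrightarrow>
      eigenvalue (L1_graph L \<omega> Z (\<phi> Z)) \<nu>1 \<Longrightarrow> eigenvalue (L1_graph L \<omega> Z (\<phi> Z)) \<nu>2 \<Longrightarrow> \<nu>1 = \<nu>2"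
proof -
  obtain \<epsilon> where "0 < \<epsilon>" and unique: "\<And>Z \<nu>1 \<nu>2 w1 w1' w2 w2'. odd_sol Z \<nu>1 w1 w1' \<Longrightarrow> odd_sol Z \<nu>2 w2 w2' \<Longrightarrow>
     (\<forall>x\<in>{0..L}. \<bar>w1 x - \<Psi>' 0 x / \<kappa>\<bar> \<le> \<epsilon> \<and> \<bar>w2 x - \<Psi>' 0 x / \<kappa>\<bar> \<le> \<epsilon>) \<Longrightarrow> \<nu>1 = \<nu>2"
    using odd_sol_unique by metis
  define Q where "Q p \<longleftrightarrow> (eigenvalue (L1_graph L \<omega> (fst p) (\<phi> (fst p))) (snd p) \<longrightarrow>
    sgn (snd p) = sgn (fst p) \<and>
    (\<exists>w w'. odd_sol (fst p) (snd p) w w' \<and> (\<forall>x\<in>{0..L}. \<bar>w x - \<Psi>' 0 x / \<kappa>\<bar> \<le> \<epsilon>)))" for p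
  have "\<forall>\<^sub>F p in near. Q p"
    using eventually_eigenfunction_odd[OF assms] eventually_odd_close[OF \<open>0 < \<epsilon>\<close>] eventually_odd_sign
    by eventually_elim (unfold Q_def, blast)
  then obtain P1 P2 where P: "\<forall>\<^sub>F Z in nhds 0. P1 Z" "\<forall>\<^sub>F \<nu> in nhds 0. P2 \<nu>"
      and PQ: "\<And>Z \<nu>. P1 Z \<Longrightarrow> P2 \<nu> \<Longrightarrow> Q (Z, \<nu>)"
    unfolding eventually_prod_filter by auto
  then obtain d1 d2 where d: "0 < d1" "0 < d2" "\<And>Z. \<bar>Z\<bar> < d1 \<Longrightarrow> P1 Z" "\<And>\<nu>. \<bar>\<nu>\<bar> < d2 \<Longrightarrow> P2 \<nu>"
    unfolding eventually_nhds_metric dist_real_def by auto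
  show ?thesis
  proof (rule that[of "min d1 d2"])
    fix Z \<nu> assume "\<bar>Z\<bar> < min d1 d2" "\<bar>\<nu>\<bar> < min d1 d2" "eigenvalue (L1_graph L \<omega> Z (\<phi> Z)) \<nu>"
    then show "sgn \<nu> = sgn Z" using PQ[OF d(3,4)] by (auto simp: Q_def)
  next
    fix Z \<nu>1 \<nu>2
    assume "\<bar>Z\<bar> < min d1 d2" "\<bar>\<nu>1\<bar> < min d1 d2" "\<bar>\<nu>2\<bar> < min d1 d2"
      "eigenvalue (L1_graph L \<omega> Z (\<phi> Z)) \<nu>1" "eigenvalue (L1_graph L \<omega> Z (\<phi> Z)) \<nu>2"
    then have "Q (Z, \<nu>1)" "Q (Z, \<nu>2)" "eigenvalue (L1_graph L \<omega> Z (\<phi> Z)) \<nu>1" "eigenvalue (L1_graph L \<omega> Z (\<phi> Z)) \<nu>2"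
      using PQ d by auto
    then obtain w1 w1' w2 w2' where "odd_sol Z \<nu>1 w1 w1'" "odd_sol Z \<nu>2 w2 w2'"
      "\<forall>x\<in>{0..L}. \<bar>w1 x - \<Psi>' 0 x / \<kappa>\<bar> \<le> \<epsilon>" "\<forall>x\<in>{0..L}. \<bar>w2 x - \<Psi>' 0 x / \<kappa>\<bar> \<le> \<epsilon>"
      unfolding Q_def fst_conv snd_conv by blast
    then show "\<nu>1 = \<nu>2" using unique by blast
  qed (use d in auto)
qed

end

section \<open>Continuity of analytic functions and counting of eigenvalues\<close>

lemma real_analytic_on_isCont:
  assumes "real_analytic_on f S" "x \<in> S" shows "isCont f x"
proof -
  obtain r c where r: "0 < r" and sums: "\<And>y. \<bar>y - x\<bar> < r \<Longrightarrow> (\<lambda>n. c n * (y - x) ^ n) sums f y"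
    using assms unfolding real_analytic_on_def by blast
  let ?g = "\<lambda>h. \<Sum>n. c n * h ^ n"
  \<comment> \<open>Convergence at \<open>r / 2\<close> puts the centre strictly inside the disc of
    convergence.\<close>
  have "summable (\<lambda>n. c n * (r / 2) ^ n)"
    using sums[of "x + r / 2"] r by (simp add: sums_iff)
  then have "isCont ?g 0" using r by (intro isCont_powser) auto
  then have "isCont (\<lambda>y. ?g (y - x)) x"
    using isCont_o2[of x "\<lambda>y. y - x" ?g] by simp
  moreover have "\<forall>\<^sub>F y in nhds x. ?g (y - x) = f y"
    using eventually_nhds_ball[OF r, of x]
    by eventually_elim (use sums in \<open>auto simp: sums_iff dist_real_def abs_minus_commute\<close>)
  ultimately show ?thesis by (rule isCont_cong[THEN iffD1, rotated])
qed

text \<open>With multiplicity 1, the bounds \<open>n < 2 \<le> n + 1\<close> leave only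
  \<open>n = 1\<close>.\<close>

lemma second_eigenvalue_count:
  assumes "nth_eigenvalue A 2 \<mu>" "eig_multiplicity A \<mu> = 1"
  shows "eigenvalue A \<mu>" "eigenvalue_count_below A \<mu> 1"
proof -
  obtain n where n: "eigenvalue_count_below A \<mu> n" "n < 2" "2 \<le> n + eig_multiplicity A \<mu>"
    and "eigenvalue A \<mu>"
    using assms(1) unfolding nth_eigenvalue_def by blast
  moreover have "n = 1" using n assms(2) by simp
  ultimately show "eigenvalue A \<mu>" "eigenvalue_count_below A \<mu> 1" by simp_all
qed

text \<open>No other eigenvalue lies between \<open>\<mu>\<close> and 0. Moving the threshold from
  \<open>\<mu>\<close> to 0 thus adds \<open>\<mu>\<close> itself if \<open>\<mu> < 0\<close> and
  changes nothing if \<open>0 < \<mu>\<close>.\<close>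

lemma eigenvalue_count_below_0:
  assumes "nth_eigenvalue A 2 \<mu>" "eig_multiplicity A \<mu> = 1"
    and unique: "\<And>\<nu>. eigenvalue A \<nu> \<Longrightarrow> \<bar>\<nu>\<bar> \<le> \<bar>\<mu>\<bar> \<Longrightarrow> \<nu> = \<mu>"
  shows "\<mu> < 0 \<Longrightarrow> eigenvalue_count_below A 0 2" "0 < \<mu> \<Longrightarrow> eigenvalue_count_below A 0 1"
proof -
  note \<mu> = second_eigenvalue_count[OF assms(1,2)]
  let ?below = "{\<nu>. eigenvalue A \<nu> \<and> \<nu> < \<mu>}"
  show "eigenvalue_count_below A 0 2" if "\<mu> < 0"
  proof -
    have "{\<nu>. eigenvalue A \<nu> \<and> \<nu> < 0} = insert \<mu> ?below"
    proof (intro set_eqI iffI)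
      fix \<nu> assume "\<nu> \<in> {\<nu>. eigenvalue A \<nu> \<and> \<nu> < 0}"
      then show "\<nu> \<in> insert \<mu> ?below" using unique[of \<nu>] by (cases "\<nu> < \<mu>") auto
    qed (use \<mu> that in auto)
    then show ?thesis
      using \<mu>(2) assms(2) by (simp add: eigenvalue_count_below_def)
  qed
  show "eigenvalue_count_below A 0 1" if "0 < \<mu>"
  proof -
    have "{\<nu>. eigenvalue A \<nu> \<and> \<nu> < 0} = ?below"
    proof (intro set_eqI iffI)
      fix \<nu> assume "\<nu> \<in> ?below"
      then show "\<nu> \<in> {\<nu>. eigenvalue A \<nu> \<and> \<nu> < 0}" using unique[of \<nu>] by (cases "\<nu> < 0") auto
    qed (use that in auto)
    then show ?thesis using \<mu>(2) by (simp add: eigenvalue_count_below_def)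
  qed
qed

text \<open>Waves are chosen for each \<open>Z \<noteq> 0\<close> and completed by the unshifted
  wave at 0. Their value at \<open>L\<close> is \<open>\<eta>\<^sub>2 Z\<close>, so the continuity
  of the branch supplies the limit.\<close>

lemma wave_family_profile:
  assumes br: "eta2_branch L \<omega> Z0 \<eta>\<^sub>2" and pos: "0 < L" "0 < \<omega>" "0 < Z0"
  obtains \<Psi> \<Psi>' where "wave_family L \<omega> Z0 (profile L \<omega> \<eta>\<^sub>2) \<Psi> \<Psi>'"
proof -
  have "\<forall>Z. \<exists>\<Psi> \<Psi>'. Z \<in> {-Z0<..<Z0} - {0} \<longrightarrow> stationary_wave L \<omega> Z (profile L \<omega> \<eta>\<^sub>2 Z) \<Psi> \<Psi>' \<and> \<Psi> L = \<eta>\<^sub>2 Z"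
    using stationary_wave_nonzero[OF br pos(1)] by (metis Diff_iff singletonI)
  then obtain \<Psi> \<Psi>' where \<Psi>: "\<And>Z. Z \<in> {-Z0<..<Z0} \<Longrightarrow> Z \<noteq> 0 \<Longrightarrow>
      stationary_wave L \<omega> Z (profile L \<omega> \<eta>\<^sub>2 Z) (\<Psi> Z) (\<Psi>' Z) \<and> \<Psi> Z L = \<eta>\<^sub>2 Z"
    by (metis Diff_iff singletonD)
  define \<Psi>0 where "\<Psi>0 = wave \<omega> (\<eta>\<^sub>2 0) 0"
  note \<eta> = eta2_0_bounds[OF br pos(2)]
  have \<Psi>0_L: "\<Psi>0 L = \<eta>\<^sub>2 0" unfolding \<Psi>0_def by (rule wave_L[OF \<eta> period_0[OF br pos(2)]])
  let ?\<Psi> = "\<Psi>(0 := \<Psi>0)" and ?\<Psi>' = "\<Psi>'(0 := wave_deriv \<omega> (\<eta>\<^sub>2 0) 0)"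
  have "(\<eta>\<^sub>2 \<longlongrightarrow> \<eta>\<^sub>2 0) (at 0)" using br by (simp add: eta2_branch_def)
  moreover have "\<forall>\<^sub>F Z in at 0. \<eta>\<^sub>2 Z = ?\<Psi> Z L"
  proof -
    have "\<forall>\<^sub>F Z in at 0. Z \<in> {-Z0<..<Z0} - {0}"
      using pos by (intro eventually_at_in_open) auto
    then show ?thesis
      by eventually_elim (use \<Psi> in auto)
  qed
  ultimately have "((\<lambda>Z. ?\<Psi> Z L) \<longlongrightarrow> ?\<Psi> 0 L) (at 0)"
    using \<Psi>0_L by (auto intro: Lim_transform_eventually)
  moreover have "\<omega> < (\<Psi>0 0)\<^sup>2"
    using \<eta> eta1_sq_pos[OF \<eta>] by (simp add: \<Psi>0_def wave_def dn_0 modulus_lt_1 power_mult_distrib)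
  moreover have "stationary_wave L \<omega> Z (profile L \<omega> \<eta>\<^sub>2 Z) (?\<Psi> Z) (?\<Psi>' Z)"
    if "Z \<in> {-Z0<..<Z0}" for Z
    using stationary_wave_0[OF br pos(2)] \<Psi>[OF that] by (cases "Z = 0") (simp_all add: \<Psi>0_def)
  moreover have "\<Psi>0 (- x) = \<Psi>0 x" for x unfolding \<Psi>0_def by (rule wave_minus[OF \<eta>])
  ultimately have "wave_family L \<omega> Z0 (profile L \<omega> \<eta>\<^sub>2) ?\<Psi> ?\<Psi>'"
    using pos \<eta> \<Psi>0_L by (intro wave_family.intro) (simp_all add: profile_0 \<Psi>0_def)
  then show ?thesis by (rule that)
qed

theorem lemma6p8:
  fixes L \<omega> Z0 :: real and \<eta>\<^sub>2 P :: "real \<Rightarrow> real"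
  assumes "L > 0" and "\<omega> > pi\<^sup>2 / (2 * L\<^sup>2)" and "Z0 > 0"
    and "eta2_branch L \<omega> Z0 \<eta>\<^sub>2"
    and "real_analytic_on P {-Z0<..<Z0}" and "P 0 = 0"
    and "\<forall>Z \<in> {-Z0<..<Z0}.
           nth_eigenvalue (L1_op L \<omega> \<eta>\<^sub>2 Z) 2 (P Z) \<and>
           eig_multiplicity (L1_op L \<omega> \<eta>\<^sub>2 Z) (P Z) = 1 \<and>
           of_real (P Z) isolated_in spectrum L (L1_op L \<omega> \<eta>\<^sub>2 Z)"
    and "\<forall>Z \<in> {-Z0<..<Z0}. \<forall>z \<in> spectrum L (L1_op L \<omega> \<eta>\<^sub>2 Z).
           (\<exists>\<mu>. z = of_real \<mu> \<and>
              (\<mu> > 0 \<or> nth_eigenvalue (L1_op L \<omega> \<eta>\<^sub>2 Z) 1 \<mu> \<or> nth_eigenvalue (L1_op L \<omega> \<eta>\<^sub>2 Z) 2 \<mu>))"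
  shows "(\<exists>Z1. 0 < Z1 \<and> Z1 < Z0 \<and>
            (\<forall>Z \<in> {-Z1<..<0}. P Z < 0) \<and> (\<forall>Z \<in> {0<..<Z1}. P Z > 0)) \<and>
         (\<forall>\<^sub>F Z in at_left 0. eigenvalue_count_below (L1_op L \<omega> \<eta>\<^sub>2 Z) 0 2) \<and>
         (\<forall>\<^sub>F Z in at_right 0. eigenvalue_count_below (L1_op L \<omega> \<eta>\<^sub>2 Z) 0 1)"
proof -
  let ?A = "L1_op L \<omega> \<eta>\<^sub>2"
  have "0 < pi\<^sup>2 / (2 * L\<^sup>2)" using assms(1) by simp
  then have "0 < \<omega>" using assms(2) by linarith
  then obtain \<Psi> \<Psi>' where "wave_family L \<omega> Z0 (profile L \<omega> \<eta>\<^sub>2) \<Psi> \<Psi>'"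
    by (rule wave_family_profile[OF assms(4,1) _ assms(3)])
  then interpret wave_family L \<omega> Z0 "profile L \<omega> \<eta>\<^sub>2" \<Psi> \<Psi>' .
  have nth: "nth_eigenvalue (?A Z) 2 (P Z)" "eig_multiplicity (?A Z) (P Z) = 1" if "Z \<in> {-Z0<..<Z0}" for Z
    using assms(7) that by auto
  \<comment> \<open>As \<open>P 0 = 0\<close>, the simplicity assumed at \<open>Z = 0\<close> says
    that the kernel is one-dimensional.\<close>
  have mult: "eig_multiplicity (L1_graph L \<omega> 0 (profile L \<omega> \<eta>\<^sub>2 0)) 0 = 1"
    using nth(2)[of 0] assms(3,6) by (simp add: L1_op_def)
  obtain \<delta> where "0 < \<delta>"
    and sign: "\<And>Z \<nu>. \<bar>Z\<bar> < \<delta> \<Longrightarrow> \<bar>\<nu>\<bar> < \<delta> \<Longrightarrow> eigenvalue (?A Z) \<nu> \<Longrightarrow> sgn \<nu> = sgn Z"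
    and unique: "\<And>Z \<nu>1 \<nu>2. \<bar>Z\<bar> < \<delta> \<Longrightarrow> \<bar>\<nu>1\<bar> < \<delta> \<Longrightarrow> \<bar>\<nu>2\<bar> < \<delta> \<Longrightarrow>
      eigenvalue (?A Z) \<nu>1 \<Longrightarrow> eigenvalue (?A Z) \<nu>2 \<Longrightarrow> \<nu>1 = \<nu>2"
    by (rule small_eigenvalues[OF mult, folded L1_op_def], rule that)
  have "isCont P 0" using real_analytic_on_isCont[OF assms(5)] assms(3) by simp
  then have "(P \<longlongrightarrow> 0) (nhds 0)"
    using assms(6) tendsto_at_iff_tendsto_nhds[of P 0] by (simp add: isCont_def)
  then have "\<forall>\<^sub>F Z in nhds 0. \<bar>P Z\<bar> < \<delta>"
    using \<open>0 < \<delta>\<close> by (auto dest: tendstoD simp: dist_real_def)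
  then obtain d where "0 < d" and d: "\<And>Z. \<bar>Z\<bar> < d \<Longrightarrow> \<bar>P Z\<bar> < \<delta>"
    unfolding eventually_nhds_metric dist_real_def by auto
  \<comment> \<open>Halving gives strict inequalities. Below \<open>d\<close> the eigenvalue
    \<open>P Z\<close> is itself smaller than \<open>\<delta>\<close>, so sign and uniqueness apply
    to it.\<close>
  define Z1 where "Z1 = min (min d \<delta>) Z0 / 2"
  have Z1: "0 < Z1" "Z1 < d" "Z1 < \<delta>" "Z1 < Z0"
    using \<open>0 < d\<close> \<open>0 < \<delta>\<close> assms(3) by (auto simp: Z1_def)
  have small: "sgn (P Z) = sgn Z" "\<And>\<nu>. eigenvalue (?A Z) \<nu> \<Longrightarrow> \<bar>\<nu>\<bar> \<le> \<bar>P Z\<bar> \<Longrightarrow> \<nu> = P Z"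
    and nth': "nth_eigenvalue (?A Z) 2 (P Z)" "eig_multiplicity (?A Z) (P Z) = 1"
    if "\<bar>Z\<bar> < Z1" for Z
  proof -
    have "Z \<in> {-Z0<..<Z0}" using that Z1 by auto
    then show nth': "nth_eigenvalue (?A Z) 2 (P Z)" "eig_multiplicity (?A Z) (P Z) = 1"
      by (rule nth)+
    have ev: "eigenvalue (?A Z) (P Z)" using nth' by (rule second_eigenvalue_count)
    then show "sgn (P Z) = sgn Z" using that Z1 d[of Z] by (intro sign) auto
    show "\<nu> = P Z" if "eigenvalue (?A Z) \<nu>" "\<bar>\<nu>\<bar> \<le> \<bar>P Z\<bar>" for \<nu>
      using that \<open>\<bar>Z\<bar> < Z1\<close> Z1 d[of Z] ev by (intro unique[of Z]) auto
  qed
  have neg: "P Z < 0" "eigenvalue_count_below (?A Z) 0 2" if "Z \<in> {-Z1<..<0}" for Z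
  proof -
    have Z: "\<bar>Z\<bar> < Z1" using that by auto
    show "P Z < 0" using small(1)[OF Z] that by (simp add: sgn_if split: if_splits)
    then show "eigenvalue_count_below (?A Z) 0 2"
      by (rule eigenvalue_count_below_0(1)[OF nth'[OF Z], rotated]) (rule small(2)[OF Z])
  qed
  have pos: "0 < P Z" "eigenvalue_count_below (?A Z) 0 1" if "Z \<in> {0<..<Z1}" for Z
  proof -
    have Z: "\<bar>Z\<bar> < Z1" using that by auto
    show "0 < P Z" using small(1)[OF Z] that by (simp add: sgn_if split: if_splits)
    then show "eigenvalue_count_below (?A Z) 0 1"
      by (rule eigenvalue_count_below_0(2)[OF nth'[OF Z], rotated]) (rule small(2)[OF Z])
  qed
  have "\<forall>\<^sub>F Z in at_left 0. Z \<in> {-Z1<..<0}"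
    using Z1 by (intro eventually_at_left_real) simp
  then have "\<forall>\<^sub>F Z in at_left 0. eigenvalue_count_below (?A Z) 0 2"
    by (rule eventually_mono) (rule neg(2))
  moreover have "\<forall>\<^sub>F Z in at_right 0. Z \<in> {0<..<Z1}"
    using Z1 by (intro eventually_at_right_real) simp
  then have "\<forall>\<^sub>F Z in at_right 0. eigenvalue_count_below (?A Z) 0 1"
    by (rule eventually_mono) (rule pos(2))
  moreover have "\<forall>Z \<in> {-Z1<..<0}. P Z < 0" "\<forall>Z \<in> {0<..<Z1}. P Z > 0"
    using neg(1) pos(1) by blast+
  ultimately show ?thesis using Z1(1,4) by blast
qed

end
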